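(* There is a co-c.e. comeager set $A\subseteq2^{\mathbb N}$ such that no point of $A$ is low for $\Omega$.
   Context: $\mathcal A_+(2^{\mathbb N})$ is the represented space of closed subsets $A$ of $2^{\mathbb N}$, where a name of $A$ is a name of a sequence $(x_n)_n$ in $2^{\mathbb N}\sqcup\{\infty\}$ with $\overline{\{x_n:n\in\mathbb N\}}\cap2^{\mathbb N}=A$, with $\infty$ an added isolated point (so a computable sequence in $\mathcal A_+(2^{\mathbb N})$ is given by a computable double sequence of such points). A set $A\subseteq2^{\mathbb N}$ is co-c.e. comeager if there is a computable sequence $(A_i)_i$ in $\mathcal A_+(2^{\mathbb N})$ such that all $A_i$ are nowhere dense and $2^{\mathbb N}\setminus A=\bigcup_{i=0}^\infty A_i$. $\mathsf{MLR}(p)$ is the set of all $q\in2^{\mathbb N}$ that are Martin-Löf random relative to $p\in2^{\mathbb N}$. $\Omega\in2^{\mathbb N}$ is the Chaitin number (the binary expansion of the halting probability of a fixed universal prefix-free machine), a left-c.e. Martin-Löf random point. A point $p\in2^{\mathbb N}$ is low for $\Omega$ if $\Omega\in\mathsf{MLR}(p)$. *)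

theory Defs
  imports "HOL-Probability.Probability" "HOL-Library.Sublist" "HOL-Library.Nat_Bijection"
begin

section \<open>Computability relative to an oracle\<close>

text \<open>Cantor space carries the product topology of the discrete type \<^typ>\<open>bool\<close>.\<close>

type_synonym cantor = "nat \<Rightarrow> bool"

text \<open>
  Kleene's mu-recursive functions of several arguments with an oracle \<open>p\<close>.  Arities are not
  enforced: surplus arguments are ignored, and a term applied to too few arguments diverges.
\<close>

datatype recf =
    RZero
  | RSucc
  | RProj nat
  | ROracle
  | RComp recf "recf list"
  | RPrim recf recf
  | RMu recf

inductive recf_eval :: "cantor \<Rightarrow> recf \<Rightarrow> nat list \<Rightarrow> nat \<Rightarrow> bool" for p :: cantor where
  zero: "recf_eval p RZero xs 0"
| succ: "recf_eval p RSucc (x # xs) (Suc x)"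
| proj: "i < length xs \<Longrightarrow> recf_eval p (RProj i) xs (xs ! i)"
| query: "recf_eval p ROracle (x # xs) (of_bool (p x))"
| comp: "list_all2 (\<lambda>g y. recf_eval p g xs y) gs ys \<Longrightarrow> recf_eval p f ys z
    \<Longrightarrow> recf_eval p (RComp f gs) xs z"
| prim_0: "recf_eval p f xs y \<Longrightarrow> recf_eval p (RPrim f g) (0 # xs) y"
| prim_Suc: "recf_eval p (RPrim f g) (n # xs) r \<Longrightarrow> recf_eval p g (n # r # xs) y
    \<Longrightarrow> recf_eval p (RPrim f g) (Suc n # xs) y"
| mu: "recf_eval p f (n # xs) 0 \<Longrightarrow> \<forall>m<n. \<exists>y. recf_eval p f (m # xs) y \<and> y > 0
    \<Longrightarrow> recf_eval p (RMu f) xs n"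

text \<open>Unrelativised computability is computability relative to the all-\<open>False\<close> oracle.\<close>

abbreviation no_oracle :: cantor where
  "no_oracle \<equiv> \<lambda>_. False"

definition computable :: "(nat \<Rightarrow> nat) \<Rightarrow> bool" where
  "computable r \<longleftrightarrow> (\<exists>f. \<forall>n. recf_eval no_oracle f [n] (r n))"

definition ce_in :: "cantor \<Rightarrow> nat set \<Rightarrow> bool" where
  "ce_in p W \<longleftrightarrow> (\<exists>f. W = {n. \<exists>y. recf_eval p f [n] y})"

definition str_code :: "bool list \<Rightarrow> nat" where
  "str_code \<sigma> = list_encode (map of_bool \<sigma>)"


section \<open>The represented space of closed sets with positive information\<close>

text \<open>
  Points of \<open>2\<^sup>\<nat> \<squnion> {\<infinity>}\<close> are modelled by \<^typ>\<open>cantor option\<close>, with \<open>None\<close> for the isolated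
  point \<open>\<infinity>\<close>.  As usual for coproducts of represented spaces, a name consists of a tag followed
  by a name in the respective summand.
\<close>

definition cantor_infty_top :: "cantor option topology" where
  "cantor_infty_top = topology (\<lambda>U. open (Some -` U))"

lemma openin_cantor_infty_top: "openin cantor_infty_top U \<longleftrightarrow> open (Some -` U)"
proof -
  have "istopology (\<lambda>U :: cantor option set. open (Some -` U))"
    unfolding istopology_def by (auto simp: vimage_Union)
  then show ?thesis
    by (simp add: cantor_infty_top_def topology_inverse')
qed

fun is_point_name :: "(nat \<Rightarrow> nat) \<Rightarrow> cantor option \<Rightarrow> bool" where
  "is_point_name r None \<longleftrightarrow> r 0 = 1"
| "is_point_name r (Some x) \<longleftrightarrow> r 0 = 0 \<and> (\<forall>k. r (Suc k) = of_bool (x k))"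

text \<open>Component \<open>i\<close> of a name of a sequence.\<close>

definition component :: "(nat \<Rightarrow> nat) \<Rightarrow> nat \<Rightarrow> nat \<Rightarrow> nat" where
  "component r i = (\<lambda>j. r (prod_encode (i, j)))"

definition is_Aplus_name :: "(nat \<Rightarrow> nat) \<Rightarrow> cantor set \<Rightarrow> bool" where
  "is_Aplus_name r A \<longleftrightarrow>
    (\<exists>x :: nat \<Rightarrow> cantor option.
      (\<forall>n. is_point_name (component r n) (x n)) \<and>
      Some -` (cantor_infty_top closure_of range x) = A)"

definition computable_Aplus_seq :: "(nat \<Rightarrow> cantor set) \<Rightarrow> bool" where
  "computable_Aplus_seq A \<longleftrightarrow>
    (\<exists>r. computable r \<and> (\<forall>i. is_Aplus_name (component r i) (A i)))"

definition nowhere_dense :: "'a::topological_space set \<Rightarrow> bool" where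
  "nowhere_dense S \<longleftrightarrow> interior (closure S) = {}"

definition co_ce_comeager :: "cantor set \<Rightarrow> bool" where
  "co_ce_comeager A \<longleftrightarrow>
    (\<exists>B. computable_Aplus_seq B \<and> (\<forall>i. nowhere_dense (B i)) \<and> - A = (\<Union>i. B i))"


section \<open>Martin-Loef randomness\<close>

definition coin_measure :: "cantor measure" where
  "coin_measure = (\<Pi>\<^sub>M n\<in>UNIV. measure_pmf (bernoulli_pmf (1/2)))"

definition cylinder :: "bool list \<Rightarrow> cantor set" where
  "cylinder \<sigma> = {x. \<forall>i<length \<sigma>. x i = \<sigma> ! i}"

definition ce_open_seq :: "cantor \<Rightarrow> (nat \<Rightarrow> cantor set) \<Rightarrow> bool" where
  "ce_open_seq p U \<longleftrightarrow>
    (\<exists>W. ce_in p W \<and> (\<forall>n. U n = \<Union> {cylinder \<sigma> |\<sigma>. prod_encode (n, str_code \<sigma>) \<in> W}))"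

definition martin_loef_test :: "cantor \<Rightarrow> (nat \<Rightarrow> cantor set) \<Rightarrow> bool" where
  "martin_loef_test p U \<longleftrightarrow> ce_open_seq p U \<and> (\<forall>n. measure coin_measure (U n) \<le> (1/2) ^ n)"

definition MLR :: "cantor \<Rightarrow> cantor set" where
  "MLR p = {q. \<not> (\<exists>U. martin_loef_test p U \<and> q \<in> (\<Inter>n. U n))}"


section \<open>The Chaitin number\<close>

definition prefix_free_machine :: "(bool list \<rightharpoonup> bool list) \<Rightarrow> bool" where
  "prefix_free_machine M \<longleftrightarrow>
    (\<exists>f. \<forall>\<sigma> y. recf_eval no_oracle f [str_code \<sigma>] y \<longleftrightarrow> y \<in> str_code ` set_option (M \<sigma>)) \<and>
    (\<forall>\<sigma>\<in>dom M. \<forall>\<tau>\<in>dom M. prefix \<sigma> \<tau> \<longrightarrow> \<sigma> = \<tau>)"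

text \<open>
  Universality in the weak sense of optimality: every prefix-free machine is simulated with
  descriptions longer by at most a constant.  In particular this covers machines universal by
  adjunction, i.e. with \<open>U (\<rho> @ \<sigma>) = M \<sigma>\<close> for a string \<open>\<rho>\<close> depending only on \<open>M\<close>.
\<close>

definition universal_prefix_free_machine :: "(bool list \<rightharpoonup> bool list) \<Rightarrow> bool" where
  "universal_prefix_free_machine U \<longleftrightarrow>
    prefix_free_machine U \<and>
    (\<forall>M. prefix_free_machine M \<longrightarrow>
      (\<exists>c. \<forall>\<sigma>\<in>dom M. \<exists>\<tau>. U \<tau> = M \<sigma> \<and> length \<tau> \<le> length \<sigma> + c))"

text \<open>The sum converges by Kraft's inequality, as the domain is prefix-free.\<close>

definition halting_probability :: "(bool list \<rightharpoonup> bool list) \<Rightarrow> real" where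
  "halting_probability U = (\<Sum>\<^sub>\<infinity>\<sigma>\<in>dom U. (1/2) ^ length \<sigma>)"

text \<open>
  For \<open>0 \<le> x < 1\<close> this is the binary expansion \<open>x = (\<Sum>k. of_bool (binary_expansion x k) / 2 ^ Suc k)\<close>.
  The halting probability of a universal machine lies strictly between 0 and 1 and is irrational,
  so that its expansion is unique.
\<close>

definition binary_expansion :: "real \<Rightarrow> cantor" where
  "binary_expansion x k \<longleftrightarrow> odd \<lfloor>2 ^ Suc k * x\<rfloor>"

definition Chaitin_Omega :: "(bool list \<rightharpoonup> bool list) \<Rightarrow> cantor" where
  "Chaitin_Omega U = binary_expansion (halting_probability U)"

definition low_for_Omega :: "(bool list \<rightharpoonup> bool list) \<Rightarrow> cantor \<Rightarrow> bool" where
  "low_for_Omega U p \<longleftrightarrow> Chaitin_Omega U \<in> MLR p"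

end

theory Submission
  imports Defs
begin

text \<open>
  Let \<open>\<alpha>\<close> be the limit of a computable increasing sequence of rationals \<open>q\<^sub>t\<close>; the halting
  probability of a prefix-free machine is such a limit.  A sequence \<open>p\<close> proposes, for every
  precision \<open>k\<close>, the stage \<open>t\<close> at which its first one from position \<open>k\<close> on occurs, and
  thereby the interval \<open>[q\<^sub>t, q\<^sub>t + 2\<^sup>-\<^sup>k]\<close>.  These intervals are computable in \<open>p\<close>, and their total
  length over \<open>k > n + 1\<close> is small, so they form a Martin-Loef test relative to \<open>p\<close>
  (\<open>gap_test\<close>).  If \<open>p\<close> has infinitely many ones but such long gaps between them that for
  infinitely many \<open>k\<close> the proposed stage satisfies \<open>\<alpha> \<le> q\<^sub>t + 2\<^sup>-\<^sup>k\<close>, then infinitely many of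
  the intervals contain \<open>\<alpha>\<close>, the test captures \<open>\<alpha>\<close>, and \<open>\<alpha>\<close> is not random relative to \<open>p\<close>
  (\<open>not_MLR\<close>).

  A generic \<open>p\<close> has such gaps, and the exceptions can be enumerated.  An exceptional \<open>p\<close> either
  vanishes from some \<open>i\<close> on, or from some \<open>i\<close> on all its gaps are short.  A gap at \<open>k\<close> that
  ends at stage \<open>t\<close> is short if it is trivial or \<open>q\<^sub>t + 2\<^sup>-\<^sup>k < q\<^sub>u\<close> for some \<open>u\<close>, which is a
  c.e. condition.  A string all of whose gaps have been seen to be short is continued by ones;
  this produces no further gaps and hence, uniformly in \<open>i\<close>, a computable dense sequence of
  exceptional points (\<open>always_early_in_meagre_part\<close>).  Its closure is nowhere dense because every
  string has an extension with a long gap (\<open>nowhere_dense_meagre_part\<close>).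

  Two ingredients connect this with the machine.  The halting probability is approximated by
  running the machine for finitely many steps, for which every oracle-free computation is
  represented by a total computable function of an additional stage
  (\<open>Kleene_normal_form\<close>).  The sum over all halting programs converges by
  Kraft's inequality.
\<close>

section \<open>Computable functions of finitely many arguments\<close>

text \<open>
  Arguments are passed as an environment \<open>v\<close>, of which \<open>F\<close> may use any finite part.  Allowing
  any number \<open>n \<ge> k\<close> of arguments frees the closure properties below of all arity side
  conditions, and a bound variable is a shift \<open>\<lambda>i. w (Suc i)\<close> of the environment,
  which beta reduction resolves.  Hence computability of a concrete expression follows by
  applying introduction rules along its syntax.
\<close>

definition computable_with :: "cantor \<Rightarrow> ((nat \<Rightarrow> nat) \<Rightarrow> nat) \<Rightarrow> bool" where
  "computable_with p F \<longleftrightarrow> (\<exists>g k. \<forall>v. \<forall>n\<ge>k. recf_eval p g (map v [0..<n]) (F v))"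

lemma map_case_nat_upt: "map (case_nat m v) [0..<Suc n] = m # map v [0..<n]"
  by (induction n) auto

lemma computable_with_var: "computable_with p (\<lambda>v. v i)"
  unfolding computable_with_def
proof (intro exI allI impI)
  fix v :: "nat \<Rightarrow> nat" and n assume "Suc i \<le> n"
  then show "recf_eval p (RProj i) (map v [0..<n]) (v i)"
    using recf_eval.proj[of i "map v [0..<n]" p] by simp
qed

lemma computable_with_zero: "computable_with p (\<lambda>v. 0)"
  unfolding computable_with_def by (blast intro: recf_eval.zero)

lemma computable_with_subst:
  assumes F: "computable_with p F" and E: "\<And>i. computable_with p (E i)"
  shows "computable_with p (\<lambda>v. F (\<lambda>i. E i v))"
proof -
  obtain g k where g: "recf_eval p g (map v [0..<n]) (F v)" if "k \<le> n" for v n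
    using F unfolding computable_with_def by blast
  obtain e l where e: "recf_eval p (e i) (map v [0..<n]) (E i v)" if "l i \<le> n" for i v n
    using E unfolding computable_with_def by metis
  have "recf_eval p (RComp g (map e [0..<k])) (map v [0..<n]) (F (\<lambda>i. E i v))"
    if n: "(\<Sum>i<k. l i) \<le> n" for v n
  proof (rule recf_eval.comp)
    have "l i \<le> n" if "i < k" for i
      using member_le_sum[of i "{..<k}" l] that n by simp
    then show "list_all2 (\<lambda>g y. recf_eval p g (map v [0..<n]) y) (map e [0..<k])
        (map (\<lambda>i. E i v) [0..<k])"
      by (auto simp: list_all2_conv_all_nth intro!: e)
    show "recf_eval p g (map (\<lambda>i. E i v) [0..<k]) (F (\<lambda>i. E i v))"
      by (rule g) simp
  qed
  then show ?thesis
    unfolding computable_with_def by blast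
qed

lemma computable_with_subst1:
  assumes "computable_with p (\<lambda>v. f (v 0))" "computable_with p X"
  shows "computable_with p (\<lambda>v. f (X v))"
  using computable_with_subst[OF assms(1), of "\<lambda>_. X"] assms(2) by simp

lemma computable_with_subst2:
  assumes "computable_with p (\<lambda>v. f (v 0) (v 1))" "computable_with p X" "computable_with p Y"
  shows "computable_with p (\<lambda>v. f (X v) (Y v))"
proof -
  have "computable_with p ((case_nat X (\<lambda>_. Y)) i)" for i
    using assms(2,3) by (cases i) auto
  from computable_with_subst[OF assms(1), of "case_nat X (\<lambda>_. Y)", OF this] show ?thesis by simp
qed

lemma computable_with_subst3:
  assumes "computable_with p (\<lambda>v. f (v 0) (v 1) (v 2))" "computable_with p X" "computable_with p Y"
    "computable_with p Z"
  shows "computable_with p (\<lambda>v. f (X v) (Y v) (Z v))"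
proof -
  have "computable_with p ((case_nat X (case_nat Y (\<lambda>_. Z))) i)" for i
    using assms(2-) by (auto split: nat.split)
  from computable_with_subst[OF assms(1), of "case_nat X (case_nat Y (\<lambda>_. Z))", OF this]
  show ?thesis by (simp add: numeral_2_eq_2)
qed

lemma computable_with_subst_env:
  assumes "computable_with p (\<lambda>w. G (w 0) (\<lambda>i. w (Suc i)))"
    and "computable_with p X" and "\<And>i. computable_with p (E i)"
  shows "computable_with p (\<lambda>v. G (X v) (\<lambda>i. E i v))"
proof -
  have "computable_with p ((case_nat X E) i)" for i
    using assms(2,3) by (cases i) auto
  from computable_with_subst[OF assms(1), of "case_nat X E", OF this] show ?thesis by simp
qed

lemma computable_with_Suc:
  assumes "computable_with p X"
  shows "computable_with p (\<lambda>v. Suc (X v))"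
proof (rule computable_with_subst1[OF _ assms])
  have "recf_eval p RSucc (map v [0..<n]) (Suc (v 0))" if "1 \<le> n" for v n
    using that recf_eval.succ[of p "v 0"] by (simp add: upt_conv_Cons)
  then show "computable_with p (\<lambda>v. Suc (v 0))"
    unfolding computable_with_def by blast
qed

lemma decidable_with_oracle:
  assumes "computable_with p X"
  shows "computable_with p (\<lambda>v. of_bool (p (X v)))"
proof (rule computable_with_subst1[OF _ assms])
  have "recf_eval p ROracle (map v [0..<n]) (of_bool (p (v 0)))" if "1 \<le> n" for v n
    using that recf_eval.query[of p "v 0"] by (simp add: upt_conv_Cons)
  then show "computable_with p (\<lambda>v. of_bool (p (v 0)))"
    unfolding computable_with_def by blast
qed

text \<open>
  Both the start value and the step may use the ambient environment \<open>v\<close>, so that recursions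
  with parameters need no currying by hand.
\<close>

lemma computable_with_rec_nat:
  assumes A: "computable_with p A"
    and B: "computable_with p (\<lambda>w. B (w 0) (w 1) (\<lambda>i. w (Suc (Suc i))))"
    and C: "computable_with p C"
  shows "computable_with p (\<lambda>v. rec_nat (A v) (\<lambda>m r. B m r v) (C v))"
proof -
  obtain a k where a: "recf_eval p a (map v [0..<n]) (A v)" if "k \<le> n" for v n
    using A unfolding computable_with_def by blast
  obtain b l where b: "recf_eval p b (map w [0..<n]) (B (w 0) (w 1) (\<lambda>i. w (Suc (Suc i))))"
    if "l \<le> n" for w n
    using B unfolding computable_with_def by blast
  have step: "recf_eval p (RPrim a b) (m # map v [0..<n]) (rec_nat (A v) (\<lambda>m r. B m r v) m)"
    if n: "k + l \<le> n" for v n m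
  proof (induction m)
    case 0
    show ?case using n by (auto intro!: recf_eval.prim_0 a)
  next
    case (Suc m)
    let ?r = "rec_nat (A v) (\<lambda>m r. B m r v) m"
    have "recf_eval p b (map (case_nat m (case_nat ?r v)) [0..<Suc (Suc n)]) (B m ?r v)"
      using b[of "Suc (Suc n)" "case_nat m (case_nat ?r v)"] n by (simp del: upt_Suc)
    then have "recf_eval p b (m # ?r # map v [0..<n]) (B m ?r v)"
      by (simp only: map_case_nat_upt)
    with Suc show ?case by (auto intro: recf_eval.prim_Suc)
  qed
  have "computable_with p (\<lambda>w. rec_nat (A (\<lambda>i. w (Suc i))) (\<lambda>m r. B m r (\<lambda>i. w (Suc i))) (w 0))"
    unfolding computable_with_def
  proof (intro exI allI impI)
    fix w :: "nat \<Rightarrow> nat" and n assume n: "Suc (k + l) \<le> n"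
    then obtain n' where n': "n = Suc n'" by (cases n) auto
    have "map w [0..<n] = w 0 # map (\<lambda>i. w (Suc i)) [0..<n']"
      using map_case_nat_upt[of "w 0" "\<lambda>i. w (Suc i)" n'] n'
      by (simp del: upt_Suc add: upt_conv_Cons map_Suc_upt[symmetric])
    then show "recf_eval p (RPrim a b) (map w [0..<n])
        (rec_nat (A (\<lambda>i. w (Suc i))) (\<lambda>m r. B m r (\<lambda>i. w (Suc i))) (w 0))"
      using step[of n' "w 0" "\<lambda>i. w (Suc i)"] n n' by simp
  qed
  from computable_with_subst_env[OF this, of C "\<lambda>i v. v i"]
  show ?thesis using C computable_with_var by simp
qed

named_theorems computability

lemmas [computability] =
  computable_with_var computable_with_zero computable_with_Suc decidable_with_oracle
  computable_with_rec_nat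

lemma computable_with_const [computability]: "computable_with p (\<lambda>v. c)"
  by (induction c) (auto intro: computability)

lemma computable_with_add [computability]:
  assumes "computable_with p X" "computable_with p Y"
  shows "computable_with p (\<lambda>v. X v + Y v)"
proof -
  have "rec_nat (X v) (\<lambda>_ r. Suc r) n = X v + n" for v n
    by (induction n) auto
  moreover have "computable_with p (\<lambda>v. rec_nat (X v) (\<lambda>_ r. Suc r) (Y v))"
    by (intro computability assms)
  ultimately show ?thesis by simp
qed

lemma computable_with_mult [computability]:
  assumes "computable_with p X" "computable_with p Y"
  shows "computable_with p (\<lambda>v. X v * Y v)"
proof (rule computable_with_subst2[OF _ assms])
  have "rec_nat 0 (\<lambda>_ r. r + x) n = x * n" for n x :: nat
    by (induction n) auto
  moreover have "computable_with p (\<lambda>v. rec_nat 0 (\<lambda>_ r. r + v 0) (v 1))"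
    by (intro computability)
  ultimately show "computable_with p (\<lambda>v. v 0 * v 1)" by simp
qed

lemma computable_with_power [computability]:
  assumes "computable_with p X" "computable_with p Y"
  shows "computable_with p (\<lambda>v. X v ^ Y v)"
proof (rule computable_with_subst2[OF _ assms])
  have "rec_nat 1 (\<lambda>_ r. r * x) n = x ^ n" for n x :: nat
    by (induction n) auto
  moreover have "computable_with p (\<lambda>v. rec_nat 1 (\<lambda>_ r. r * v 0) (v 1))"
    by (intro computability)
  ultimately show "computable_with p (\<lambda>v. v 0 ^ v 1)" by simp
qed

lemma computable_with_predecessor:
  assumes "computable_with p X"
  shows "computable_with p (\<lambda>v. X v - 1)"
proof (rule computable_with_subst1[OF _ assms])
  have "rec_nat 0 (\<lambda>m _. m) n = n - 1" for n :: nat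
    by (cases n) auto
  moreover have "computable_with p (\<lambda>v. rec_nat 0 (\<lambda>m _. m) (v 0))"
    by (intro computability)
  ultimately show "computable_with p (\<lambda>v. v 0 - 1)" by simp
qed

lemma computable_with_diff [computability]:
  assumes "computable_with p X" "computable_with p Y"
  shows "computable_with p (\<lambda>v. X v - Y v)"
proof (rule computable_with_subst2[OF _ assms])
  have "rec_nat x (\<lambda>_ r. r - 1) n = x - n" for n x :: nat
    by (induction n) auto
  moreover have "computable_with p (\<lambda>v. rec_nat (v 0) (\<lambda>_ r. r - 1) (v 1))"
    by (intro computability computable_with_predecessor)
  ultimately show "computable_with p (\<lambda>v. v 0 - v 1)" by simp
qed

text \<open>
  Bounded sums are the source of bounded quantifiers, of division and of the decoding of pairs:
  each of these counts, or adds up, the numbers below a bound that pass a decidable check.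
\<close>

lemma computable_with_sum [computability]:
  assumes "computable_with p (\<lambda>w. P (w 0) (\<lambda>i. w (Suc i)))" "computable_with p C"
  shows "computable_with p (\<lambda>v. \<Sum>m<C v. P m v)"
proof -
  have "computable_with p (\<lambda>w. P (w 0) (\<lambda>i. w (Suc (Suc i))))"
    by (rule computable_with_subst_env[OF assms(1)]) (intro computability)+
  then have "computable_with p (\<lambda>v. rec_nat 0 (\<lambda>m r. r + P m v) (C v))"
    by (intro computability assms)
  moreover have "rec_nat 0 (\<lambda>m r. r + P m v) n = (\<Sum>m<n. P m v)" for v n
    by (induction n) auto
  ultimately show ?thesis by simp
qed

abbreviation decidable_with :: "cantor \<Rightarrow> ((nat \<Rightarrow> nat) \<Rightarrow> bool) \<Rightarrow> bool" where
  "decidable_with p P \<equiv> computable_with p (\<lambda>v. of_bool (P v))"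

lemma decidable_with_le [computability]:
  assumes "computable_with p X" "computable_with p Y"
  shows "decidable_with p (\<lambda>v. X v \<le> Y v)"
proof -
  have "of_bool (X v \<le> Y v) = 1 - (X v - Y v)" for v by simp
  then show ?thesis by (simp only:) (intro computability assms)
qed

lemma decidable_with_not [computability]:
  assumes "decidable_with p P"
  shows "decidable_with p (\<lambda>v. \<not> P v)"
proof -
  have "of_bool (\<not> P v) = (1::nat) - of_bool (P v)" for v by simp
  then show ?thesis by (simp only:) (intro computability assms)
qed

lemma decidable_with_conj [computability]:
  assumes "decidable_with p P" "decidable_with p Q"
  shows "decidable_with p (\<lambda>v. P v \<and> Q v)"
  using computable_with_mult[OF assms] by (simp add: of_bool_conj)

lemma decidable_with_disj [computability]:
  assumes "decidable_with p P" "decidable_with p Q"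
  shows "decidable_with p (\<lambda>v. P v \<or> Q v)"
proof -
  have "decidable_with p (\<lambda>v. \<not> (\<not> P v \<and> \<not> Q v))" by (intro computability assms)
  then show ?thesis by simp
qed

lemma decidable_with_imp [computability]:
  assumes "decidable_with p P" "decidable_with p Q"
  shows "decidable_with p (\<lambda>v. P v \<longrightarrow> Q v)"
  unfolding imp_conv_disj by (intro computability assms)

lemma decidable_with_less [computability]:
  assumes "computable_with p X" "computable_with p Y"
  shows "decidable_with p (\<lambda>v. X v < Y v)"
  unfolding not_le[symmetric] by (intro computability assms)

lemma decidable_with_eq [computability]:
  fixes X Y :: "(nat \<Rightarrow> nat) \<Rightarrow> nat"
  assumes "computable_with p X" "computable_with p Y"
  shows "decidable_with p (\<lambda>v. X v = Y v)"
  unfolding order_eq_iff by (intro computability assms)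

lemma decidable_with_ex [computability]:
  assumes "decidable_with p (\<lambda>w. P (w 0) (\<lambda>i. w (Suc i)))" "computable_with p C"
  shows "decidable_with p (\<lambda>v. \<exists>m<C v. P m v)"
proof -
  have "(\<exists>m<C v. P m v) \<longleftrightarrow> 0 < (\<Sum>m<C v. of_bool (P m v) :: nat)" for v
    by (simp add: zero_less_iff_neq_zero) auto
  then show ?thesis
    by (simp only:) (intro computability assms)
qed

lemma decidable_with_all [computability]:
  assumes "decidable_with p (\<lambda>w. P (w 0) (\<lambda>i. w (Suc i)))" "computable_with p C"
  shows "decidable_with p (\<lambda>v. \<forall>m<C v. P m v)"
proof -
  have "decidable_with p (\<lambda>v. \<not> (\<exists>m<C v. \<not> P m v))" by (intro computability assms)
  then show ?thesis by simp
qed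

lemma computable_with_if [computability]:
  assumes "decidable_with p P" "computable_with p X" "computable_with p Y"
  shows "computable_with p (\<lambda>v. if P v then X v else Y v)"
proof -
  have "(if P v then X v else Y v) = of_bool (P v) * X v + of_bool (\<not> P v) * Y v" for v
    by simp
  then show ?thesis by (simp only:) (intro computability assms)
qed

lemma computable_with_div [computability]:
  assumes "computable_with p X" "computable_with p Y"
  shows "computable_with p (\<lambda>v. X v div Y v)"
proof (rule computable_with_subst2[OF _ assms])
  \<comment> \<open>The quotient counts the positive multiples of the divisor that do not exceed the dividend.\<close>
  have "x div y = (if y = 0 then 0 else \<Sum>m<x. of_bool (Suc m * y \<le> x))" for x y :: nat
  proof (cases "y = 0")
    case False
    have "{..<x} \<inter> {m. Suc m * y \<le> x} = {..<x div y}"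
    proof (intro set_eqI)
      fix m
      have "Suc m * y \<le> x \<longleftrightarrow> m < x div y"
        using False less_eq_div_iff_mult_less_eq[of y "Suc m" x] by (simp add: Suc_le_eq)
      moreover have "m < x div y \<Longrightarrow> m < x"
        by (rule less_le_trans[OF _ div_le_dividend])
      ultimately show "m \<in> {..<x} \<inter> {m. Suc m * y \<le> x} \<longleftrightarrow> m \<in> {..<x div y}"
        by auto
    qed
    then show ?thesis using False by (simp add: of_bool_def sum.If_cases)
  qed simp
  then show "computable_with p (\<lambda>v. v 0 div v 1)"
    by (simp only:) (intro computability)
qed

lemma decidable_with_odd [computability]:
  assumes "computable_with p X"
  shows "decidable_with p (\<lambda>v. odd (X v))"
proof -
  have "odd n \<longleftrightarrow> \<not> n - 2 * (n div 2) = 0" for n :: nat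
    by presburger
  then show ?thesis by (simp only:) (intro computability assms)
qed

lemma computable_with_prod_encode [computability]:
  assumes "computable_with p X" "computable_with p Y"
  shows "computable_with p (\<lambda>v. prod_encode (X v, Y v))"
  unfolding prod_encode_def triangle_def split by (intro computability assms)

lemma computable_with_prod_decode_fst [computability]:
  assumes "computable_with p X"
  shows "computable_with p (\<lambda>v. fst (prod_decode (X v)))"
proof (rule computable_with_subst1[OF _ assms])
  have "fst (prod_decode n) = (\<Sum>a<Suc n. if \<exists>b<Suc n. prod_encode (a, b) = n then a else 0)" for n
  proof -
    obtain x y where n: "n = prod_encode (x, y)" by (metis prod_decode_inverse surj_pair)
    have "(\<exists>b<Suc n. prod_encode (a, b) = n) \<longleftrightarrow> a = x" for a
      using le_prod_encode_2[of y x] unfolding n by auto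
    then show ?thesis using le_prod_encode_1[of x y] by (simp add: n less_Suc_eq_le)
  qed
  then show "computable_with p (\<lambda>v. fst (prod_decode (v 0)))"
    by (simp only:) (intro computability)
qed

lemma computable_with_prod_decode_snd [computability]:
  assumes "computable_with p X"
  shows "computable_with p (\<lambda>v. snd (prod_decode (X v)))"
proof (rule computable_with_subst1[OF _ assms])
  have "snd (prod_decode n) = (\<Sum>b<Suc n. if \<exists>a<Suc n. prod_encode (a, b) = n then b else 0)" for n
  proof -
    obtain x y where n: "n = prod_encode (x, y)" by (metis prod_decode_inverse surj_pair)
    have "(\<exists>a<Suc n. prod_encode (a, b) = n) \<longleftrightarrow> b = y" for b
      using le_prod_encode_1[of x y] unfolding n by auto
    then show ?thesis using le_prod_encode_2[of y x] by (simp add: n less_Suc_eq_le)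
  qed
  then show "computable_with p (\<lambda>v. snd (prod_decode (v 0)))"
    by (simp only:) (intro computability)
qed

text \<open>
  In the definitions of computable functions and of c.e. sets a term receives exactly its
  arguments.  Padding with zeros turns it into a call with enough arguments.
\<close>

lemma computable_with_exact_arity:
  assumes "computable_with p F"
  shows "\<exists>g. \<forall>v. recf_eval p g (map v [0..<m]) (F (\<lambda>i. if i < m then v i else 0))"
proof -
  obtain g k where g: "recf_eval p g (map v [0..<n]) (F v)" if "k \<le> n" for v n
    using assms unfolding computable_with_def by blast
  let ?e = "\<lambda>i. if i < m then RProj i else RZero"
  have "recf_eval p (RComp g (map ?e [0..<k])) (map v [0..<m]) (F (\<lambda>i. if i < m then v i else 0))" for v
  proof (rule recf_eval.comp)
    let ?v = "\<lambda>i. if i < m then v i else 0"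
    show "list_all2 (\<lambda>g y. recf_eval p g (map v [0..<m]) y) (map ?e [0..<k]) (map ?v [0..<k])"
      using recf_eval.proj[of _ "map v [0..<m]" p]
      by (auto simp: list_all2_conv_all_nth intro: recf_eval.zero)
    show "recf_eval p g (map ?v [0..<k]) (F ?v)"
      by (rule g) simp
  qed
  then show ?thesis by blast
qed

lemma computableI:
  assumes "computable_with no_oracle (\<lambda>v. f (v 0))"
  shows "computable f"
proof -
  obtain g where g: "recf_eval no_oracle g (map v [0..<1]) (f (v 0))" for v
    using computable_with_exact_arity[OF assms, of 1] by auto
  show ?thesis
    unfolding computable_def using g[of "\<lambda>_. n" for n] by (intro exI[of _ g]) simp
qed

inductive_cases recf_eval_elims:
  "recf_eval p RZero xs y" "recf_eval p RSucc xs y" "recf_eval p (RProj i) xs y"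
  "recf_eval p ROracle xs y" "recf_eval p (RComp f gs) xs y"
  "recf_eval p (RPrim f g) (0 # xs) y" "recf_eval p (RPrim f g) (Suc n # xs) y"
  "recf_eval p (RPrim f g) [] y" "recf_eval p (RMu f) xs y"

lemma recf_eval_deterministic: "recf_eval p f xs y \<Longrightarrow> recf_eval p f xs z \<Longrightarrow> y = z"
proof (induction arbitrary: z rule: recf_eval.induct)
  case (comp xs gs ys f z z')
  from comp.prems obtain ys' where ys': "list_all2 (\<lambda>g y. recf_eval p g xs y) gs ys'"
    "recf_eval p f ys' z'" by (rule recf_eval_elims)
  have "ys = ys'"
  proof (rule nth_equalityI)
    show "length ys = length ys'"
      using comp.IH(1) ys'(1) by (simp add: list_all2_conv_all_nth)
    show "ys ! i = ys' ! i" if "i < length ys" for i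
      using comp.IH(1) ys'(1) that
      by (auto simp: list_all2_conv_all_nth)
  qed
  with comp.IH ys'(2) show ?case by blast
next
  case (prim_Suc f g n xs r y)
  from prim_Suc.prems show ?case by (rule recf_eval_elims) (use prim_Suc.IH in blast)
next
  case (prim_0 f xs y g)
  from prim_0.prems show ?case by (rule recf_eval_elims) (use prim_0.IH in blast)
next
  case (mu f n xs z)
  from mu.prems have z: "recf_eval p f (z # xs) 0" "\<And>m. m<z \<Longrightarrow> \<exists>y. recf_eval p f (m # xs) y \<and> y > 0"
    by (auto elim: recf_eval_elims)
  show ?case
  proof (rule linorder_cases[of n z])
    assume "n < z"
    from z(2)[OF this] mu.IH(1) show ?thesis by blast
  next
    assume "z < n"
    with z(1) mu.IH(2) show ?thesis by blast
  qed
qed (erule recf_eval_elims; simp)+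

text \<open>
  The search for the least witness halts precisely on the projection.  Determinism of the
  evaluation excludes that the search stops at a number that is not a witness.
\<close>

lemma ce_inI:
  assumes "decidable_with p (\<lambda>v. P (v 0) (v 1))"
  shows "ce_in p {x. \<exists>w. P w x}"
proof -
  have "computable_with p (\<lambda>v. of_bool (\<not> P (v 0) (v 1)))"
    by (intro computability assms)
  from computable_with_exact_arity[OF this, of 2] obtain g where
    g: "recf_eval p g (map v [0..<2]) (of_bool (\<not> P (v 0) (v 1)))" for v by auto
  have g: "recf_eval p g [w, x] (of_bool (\<not> P w x))" for w x
    using g[of "case_nat w (\<lambda>_. x)"] by (simp add: numeral_2_eq_2)
  have "(\<exists>w. P w x) \<longleftrightarrow> (\<exists>y. recf_eval p (RMu g) [x] y)" for x
  proof
    assume "\<exists>w. P w x"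
    then have least: "P (LEAST w. P w x) x" "\<And>m. m < (LEAST w. P w x) \<Longrightarrow> \<not> P m x"
      by (auto intro: LeastI dest: not_less_Least)
    have "recf_eval p (RMu g) [x] (LEAST w. P w x)"
    proof (rule recf_eval.mu)
      show "recf_eval p g [LEAST w. P w x, x] 0" using g[of "LEAST w. P w x" x] least(1) by simp
      show "\<forall>m<LEAST w. P w x. \<exists>y. recf_eval p g [m, x] y \<and> 0 < y"
        using g[of _ x] least(2) by (metis of_bool_eq(2) zero_less_one)
    qed
    then show "\<exists>y. recf_eval p (RMu g) [x] y" ..
  next
    assume "\<exists>y. recf_eval p (RMu g) [x] y"
    then obtain w where "recf_eval p g [w, x] 0" by (auto elim: recf_eval_elims)
    from recf_eval_deterministic[OF this g] show "\<exists>w. P w x" by (auto split: if_splits)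
  qed
  then show ?thesis unfolding ce_in_def by blast
qed

section \<open>Kleene normal form\<close>

text \<open>
  \<open>G s v\<close> is what stage \<open>s\<close> knows about the value of \<open>f\<close> at \<open>k\<close> arguments: \<open>0\<close> if there is no
  result yet, and \<open>Suc y\<close> if the result is \<open>y\<close>.  Although \<open>f\<close> runs without oracle, \<open>G\<close> is
  computable with every oracle, so that computations relative to \<open>p\<close> may consult it.
\<close>

definition normal_form :: "recf \<Rightarrow> nat \<Rightarrow> (nat \<Rightarrow> (nat \<Rightarrow> nat) \<Rightarrow> nat) \<Rightarrow> bool" where
  "normal_form f k G \<longleftrightarrow>
    (\<forall>p. computable_with p (\<lambda>w. G (w 0) (\<lambda>i. w (Suc i)))) \<and>
    (\<forall>s s' v y. s \<le> s' \<longrightarrow> G s v = Suc y \<longrightarrow> G s' v = Suc y) \<and>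
    (\<forall>v y. recf_eval no_oracle f (map v [0..<k]) y \<longleftrightarrow> (\<exists>s. G s v = Suc y))"

lemma normal_form_computable:
  assumes "normal_form f k G" "computable_with p X" "\<And>i. computable_with p (E i)"
  shows "computable_with p (\<lambda>v. G (X v) (\<lambda>i. E i v))"
proof (rule computable_with_subst_env[OF _ assms(2,3)])
  have "\<forall>p. computable_with p (\<lambda>w. G (w 0) (\<lambda>i. w (Suc i)))"
    using assms(1) unfolding normal_form_def by (rule conjunct1)
  then show "computable_with p (\<lambda>w. G (w 0) (\<lambda>i. w (Suc i)))" ..
qed

lemma normal_form_mono:
  assumes "normal_form f k G" "G s v = Suc y" "s \<le> s'"
  shows "G s' v = Suc y"
proof -
  have "\<forall>s s' v y. s \<le> s' \<longrightarrow> G s v = Suc y \<longrightarrow> G s' v = Suc y"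
    using assms(1) unfolding normal_form_def by (rule conjunct2[THEN conjunct1])
  from this[THEN spec[of _ s], THEN spec[of _ s'], THEN spec[of _ v], THEN spec[of _ y]] assms(2,3)
  show ?thesis by simp
qed

lemma normal_form_eval:
  assumes "normal_form f k G"
  shows "recf_eval no_oracle f (map v [0..<k]) y \<longleftrightarrow> (\<exists>s. G s v = Suc y)"
proof -
  have "\<forall>v y. recf_eval no_oracle f (map v [0..<k]) y \<longleftrightarrow> (\<exists>s. G s v = Suc y)"
    using assms unfolding normal_form_def by (rule conjunct2[THEN conjunct2])
  from this[THEN spec[of _ v], THEN spec[of _ y]] show ?thesis .
qed

lemma normal_formI:
  assumes "\<And>p. computable_with p (\<lambda>w. G (w 0) (\<lambda>i. w (Suc i)))"
    and "\<And>s s' v y. s \<le> s' \<Longrightarrow> G s v = Suc y \<Longrightarrow> G s' v = Suc y"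
    and "\<And>v y. recf_eval no_oracle f (map v [0..<k]) y \<longleftrightarrow> (\<exists>s. G s v = Suc y)"
  shows "normal_form f k G"
  unfolding normal_form_def
  using assms by (intro conjI allI impI)

lemma decidable_with_all_fixed:
  fixes n :: nat
  assumes "\<And>i. i < n \<Longrightarrow> decidable_with p (\<lambda>v. P i v)"
  shows "decidable_with p (\<lambda>v. \<forall>i<n. P i v)"
  using assms
proof (induction n)
  case (Suc n)
  have "decidable_with p (\<lambda>v. (\<forall>i<n. P i v) \<and> P n v)"
    by (rule decidable_with_conj[OF Suc.IH]) (simp_all add: Suc.prems)
  then show ?case by (simp add: All_less_Suc conj_commute)
qed (simp add: computability)

lemma normal_form_diverges:
  assumes "\<And>v y. \<not> recf_eval no_oracle f (map v [0..<k]) y"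
  shows "\<exists>G. normal_form f k G"
  by (rule exI[of _ "\<lambda>_ _. 0"], rule normal_formI) (simp_all add: assms computable_with_zero)

lemma normal_form_total:
  assumes "\<And>p. computable_with p F"
    and "\<And>v y. recf_eval no_oracle f (map v [0..<k]) y \<longleftrightarrow> y = F v"
  shows "\<exists>G. normal_form f k G"
proof (rule exI[of _ "\<lambda>_ v. Suc (F v)"], rule normal_formI)
  show "computable_with p (\<lambda>w. Suc (F (\<lambda>i. w (Suc i))))" for p
    by (intro computable_with_Suc computable_with_subst[OF assms(1)] computable_with_var)
qed (auto simp: assms(2))

lemma map_upt_Suc: "map v [0..<Suc k] = v 0 # map (\<lambda>i. v (Suc i)) [0..<k]"
  by (induction k) auto

text \<open>
  Since the stages are monotone, the finitely many subcomputations of a composition share the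
  sum of their stages as a common one.
\<close>

lemma normal_form_comp:
  assumes f: "normal_form f (length gs) F"
    and g: "\<And>i. i < length gs \<Longrightarrow> normal_form (gs ! i) k (H i)"
  shows "\<exists>G. normal_form (RComp f gs) k G"
proof -
  let ?E = "\<lambda>s i v. if i < length gs then H i s v - 1 else 0"
  let ?G = "\<lambda>s v. if \<forall>i<length gs. 0 < H i s v then F s (\<lambda>i. ?E s i v) else 0"
  have H: "computable_with p (\<lambda>w. H i (w 0) (\<lambda>i. w (Suc i)))" if "i < length gs" for p i
    by (intro normal_form_computable[OF g] computability that)
  have E: "computable_with p (\<lambda>w. ?E (w 0) i (\<lambda>i. w (Suc i)))" for p i
    by (cases "i < length gs") (auto intro!: computable_with_predecessor H computability)
  have comp: "computable_with p (\<lambda>w. ?G (w 0) (\<lambda>i. w (Suc i)))" for p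
    by (intro computable_with_if decidable_with_all_fixed decidable_with_less computable_with_zero
        normal_form_computable[OF f] computable_with_var E H)
  have mono: "?G s' v = Suc y" if "s \<le> s'" "?G s v = Suc y" for s s' v y
  proof -
    have pos: "0 < H i s v" if "i < length gs" for i
      using \<open>?G s v = Suc y\<close> that by (auto split: if_splits)
    have eq: "H i s' v = H i s v" if "i < length gs" for i
      using normal_form_mono[OF g[OF that], of s v "H i s v - 1" s'] pos[OF that] \<open>s \<le> s'\<close> by simp
    have E: "(\<lambda>i. ?E s' i v) = (\<lambda>i. ?E s i v)" using eq by auto
    have "F s (\<lambda>i. ?E s i v) = Suc y" using \<open>?G s v = Suc y\<close> pos by simp
    from normal_form_mono[OF f, OF this \<open>s \<le> s'\<close>] show ?thesis
      using pos by (simp only: E) (simp add: eq)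
  qed
  have eval: "recf_eval no_oracle (RComp f gs) (map v [0..<k]) y \<longleftrightarrow> (\<exists>s. ?G s v = Suc y)" for v y
  proof
    assume "recf_eval no_oracle (RComp f gs) (map v [0..<k]) y"
    then obtain ys where ys: "list_all2 (\<lambda>g y. recf_eval no_oracle g (map v [0..<k]) y) gs ys"
      and fy: "recf_eval no_oracle f ys y" by (rule recf_eval_elims)
    have len: "length ys = length gs" using ys by (simp add: list_all2_lengthD)
    let ?ys = "\<lambda>i. if i < length gs then ys ! i else 0"
    have "ys = map ?ys [0..<length gs]"
      using len by (auto intro: nth_equalityI)
    then obtain s where s: "F s ?ys = Suc y"
      using fy normal_form_eval[OF f, of ?ys y] by auto
    have "\<exists>s. H i s v = Suc (ys ! i)" if "i < length gs" for i
      using ys that normal_form_eval[OF g[OF that]] by (auto simp: list_all2_conv_all_nth)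
    then obtain t where t: "H i (t i) v = Suc (ys ! i)" if "i < length gs" for i by metis
    let ?s = "s + (\<Sum>i<length gs. t i)"
    have H: "H i ?s v = Suc (ys ! i)" if "i < length gs" for i
    proof (rule normal_form_mono[OF g[OF that], OF t[OF that]])
      have "t i \<le> (\<Sum>i<length gs. t i)" using that by (intro member_le_sum) auto
      then show "t i \<le> ?s" by simp
    qed
    then have "(\<lambda>i. ?E ?s i v) = ?ys" by auto
    then have "?G ?s v = F ?s ?ys" using H by simp
    also have "\<dots> = Suc y" by (rule normal_form_mono[OF f, OF s]) simp
    finally have "?G ?s v = Suc y" .
    then show "\<exists>s. ?G s v = Suc y" by (rule exI[of _ ?s])
  next
    assume "\<exists>s. ?G s v = Suc y"
    then obtain s where s: "?G s v = Suc y" ..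
    have H: "0 < H i s v" if "i < length gs" for i using s that by (auto split: if_splits)
    have "F s (\<lambda>i. ?E s i v) = Suc y" using s by (auto split: if_splits)
    then have fy: "recf_eval no_oracle f (map (\<lambda>i. ?E s i v) [0..<length gs]) y"
      using normal_form_eval[OF f] by blast
    have "recf_eval no_oracle (gs ! i) (map v [0..<k]) (H i s v - 1)" if "i < length gs" for i
      using H[OF that] normal_form_eval[OF g[OF that], of v "H i s v - 1"] by auto
    then have "list_all2 (\<lambda>g y. recf_eval no_oracle g (map v [0..<k]) y) gs
        (map (\<lambda>i. ?E s i v) [0..<length gs])"
      by (auto simp: list_all2_conv_all_nth)
    then show "recf_eval no_oracle (RComp f gs) (map v [0..<k]) y"
      using fy by (rule recf_eval.comp)
  qed
  show ?thesis
    by (intro exI normal_formI) (rule comp, rule mono, assumption+, rule eval)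
qed

lemma normal_form_prim:
  assumes f: "normal_form f k F" and g: "normal_form g (Suc (Suc k)) H"
  shows "\<exists>G. normal_form (RPrim f g) (Suc k) G"
proof -
  \<comment> \<open>A value is stored as its successor, and \<open>0\<close>, once it occurs, propagates as divergence.\<close>
  let ?R = "\<lambda>s v n. rec_nat (F s v) (\<lambda>m r. if r = 0 then 0 else H s (case_nat m (case_nat (r - 1) v))) n"
  let ?G = "\<lambda>s v. ?R s (\<lambda>i. v (Suc i)) (v 0)"
  have comp: "computable_with p (\<lambda>w. ?G (w 0) (\<lambda>i. w (Suc i)))" for p
  proof -
    have E: "computable_with p (\<lambda>w. case_nat (w 0) (case_nat (w 1 - 1) (\<lambda>i. w (Suc (Suc (Suc (Suc i)))))) i)" for i
    proof (cases i)
      case (Suc j)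
      then show ?thesis by (cases j) (auto intro: computability)
    qed (auto intro: computability)
    show ?thesis
      by (intro computability normal_form_computable[OF f] normal_form_computable[OF g] E[simplified])
  qed
  have mono_R: "?R s' v n = Suc y" if "s \<le> s'" "?R s v n = Suc y" for s s' v n y
    using that(2)
  proof (induction n arbitrary: y)
    case 0
    then show ?case using normal_form_mono[OF f, OF _ that(1)] by simp
  next
    case (Suc n)
    then obtain r where r: "?R s v n = Suc r" by (cases "?R s v n") auto
    with Suc.IH have "?R s' v n = Suc r" by blast
    then show ?case using Suc.prems r normal_form_mono[OF g, OF _ that(1)] by simp
  qed
  have eval_R: "recf_eval no_oracle (RPrim f g) (n # map v [0..<k]) y \<longleftrightarrow> (\<exists>s. ?R s v n = Suc y)" for v n y
  proof (induction n arbitrary: y)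
    case 0
    have "recf_eval no_oracle (RPrim f g) (0 # map v [0..<k]) y \<longleftrightarrow> recf_eval no_oracle f (map v [0..<k]) y"
      by (auto intro: recf_eval.intros elim: recf_eval_elims)
    then show ?case using normal_form_eval[OF f] by simp
  next
    case (Suc n)
    have cons: "n # r # map v [0..<k] = map (case_nat n (case_nat r v)) [0..<Suc (Suc k)]" for r
      by (simp only: map_case_nat_upt)
    have "recf_eval no_oracle (RPrim f g) (Suc n # map v [0..<k]) y \<longleftrightarrow>
        (\<exists>r. recf_eval no_oracle (RPrim f g) (n # map v [0..<k]) r \<and>
             recf_eval no_oracle g (n # r # map v [0..<k]) y)"
      by (auto intro: recf_eval.intros elim: recf_eval_elims)
    also have "\<dots> \<longleftrightarrow> (\<exists>r. (\<exists>s. ?R s v n = Suc r) \<and> (\<exists>s. H s (case_nat n (case_nat r v)) = Suc y))"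
      unfolding Suc cons normal_form_eval[OF g] by (rule refl)
    also have "\<dots> \<longleftrightarrow> (\<exists>s r. ?R s v n = Suc r \<and> H s (case_nat n (case_nat r v)) = Suc y)"
    proof safe
      fix r s t assume "?R s v n = Suc r" "H t (case_nat n (case_nat r v)) = Suc y"
      then have "?R (max s t) v n = Suc r" "H (max s t) (case_nat n (case_nat r v)) = Suc y"
        using mono_R[of s "max s t"] normal_form_mono[OF g, of t _ _ "max s t"] by auto
      then show "\<exists>s r. ?R s v n = Suc r \<and> H s (case_nat n (case_nat r v)) = Suc y" by blast
    qed blast
    also have "\<dots> \<longleftrightarrow> (\<exists>s. ?R s v (Suc n) = Suc y)"
      by (intro ex_cong1) (auto simp: gr0_conv_Suc split: if_splits)
    finally show ?case .
  qed
  have eval: "recf_eval no_oracle (RPrim f g) (map v [0..<Suc k]) y \<longleftrightarrow> (\<exists>s. ?G s v = Suc y)" for v y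
    unfolding map_upt_Suc by (rule eval_R)
  show ?thesis
    by (intro exI normal_formI) (rule comp, rule mono_R, assumption+, rule eval)
qed

lemma recf_eval_mu_iff:
  "recf_eval p (RMu f) xs n \<longleftrightarrow>
    recf_eval p f (n # xs) 0 \<and> (\<forall>m<n. \<exists>y. recf_eval p f (m # xs) y \<and> y > 0)"
  by (auto intro: recf_eval.mu elim: recf_eval_elims)

text \<open>
  A stage \<open>s\<close> searches only below \<open>s\<close>.  A candidate \<open>n\<close> counts if the value \<open>0\<close> at \<open>n\<close> and
  positive values at all smaller arguments have been found by then.  At most one \<open>n\<close> passes, so
  the sum just returns it.
\<close>

lemma normal_form_mu:
  assumes f: "normal_form f (Suc k) F"
  shows "\<exists>G. normal_form (RMu f) k G"
proof -
  let ?P = "\<lambda>s v n. F s (case_nat n v) = Suc 0 \<and> (\<forall>m<n. Suc 0 < F s (case_nat m v))"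
  let ?G = "\<lambda>s v. \<Sum>n<s. if ?P s v n then Suc n else 0"
  have unique: "n = m" if "?P s v n" "?P s v m" for s v n m
    using that by (metis less_irrefl linorder_neqE_nat)
  have G: "?G s v = Suc n \<longleftrightarrow> n < s \<and> ?P s v n" for s v n
  proof (cases "\<exists>m<s. ?P s v m")
    case True
    then obtain m where m: "m < s" "?P s v m" by blast
    then have "?P s v n \<longleftrightarrow> n = m" for n using unique by blast
    then have "?G s v = (\<Sum>n<s. if n = m then Suc n else 0)" by simp
    also have "\<dots> = Suc m" using m(1) by simp
    finally have sum: "?G s v = Suc m" .
    have iff: "n < s \<and> ?P s v n \<longleftrightarrow> m = n" using m unique[of s n v m] by blast
    show ?thesis unfolding sum iff by simp
  next
    case False
    then have "?G s v = 0" by auto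
    with False show ?thesis by (metis nat.distinct(1))
  qed
  have comp: "computable_with p (\<lambda>w. ?G (w 0) (\<lambda>i. w (Suc i)))" for p
  proof -
    have E: "computable_with p (\<lambda>w. case_nat (w a) (\<lambda>i. w (b + i)) i)" for a b i
      by (cases i) (auto intro: computability)
    have F: "computable_with p (\<lambda>w. F (w a) (case_nat (w b) (\<lambda>i. w (c + i))))" for a b c
      by (rule normal_form_computable[OF f]) (intro computability E)+
    show ?thesis
      using F[of 1 0 2] F[of 2 0 3] by (intro computability) (simp_all add: numeral_eq_Suc)
  qed
  have mono_P: "?P s' v n" if "s \<le> s'" "?P s v n" for s s' v n
  proof -
    have "F s' (case_nat m v) = F s (case_nat m v)" if "m \<le> n" for m
    proof -
      have "0 < F s (case_nat m v)"
        using \<open>?P s v n\<close> that by (cases "m = n") (auto dest!: spec[of _ m])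
      then have "F s (case_nat m v) = Suc (F s (case_nat m v) - 1)" by simp
      from normal_form_mono[OF f, OF this \<open>s \<le> s'\<close>] this show ?thesis by simp
    qed
    with \<open>?P s v n\<close> show ?thesis by simp
  qed
  have mono: "?G s' v = Suc n" if "s \<le> s'" "?G s v = Suc n" for s s' v n
    using that(2) mono_P[OF that(1)] that(1) unfolding G by auto
  have eval: "recf_eval no_oracle (RMu f) (map v [0..<k]) n \<longleftrightarrow> (\<exists>s. ?G s v = Suc n)" for v n
  proof -
    let ?eval = "\<lambda>m y. \<exists>s. F s (case_nat m v) = Suc y"
    have cons: "m # map v [0..<k] = map (case_nat m v) [0..<Suc k]" for m
      by (simp only: map_case_nat_upt)
    have "recf_eval no_oracle (RMu f) (map v [0..<k]) n \<longleftrightarrow>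
        ?eval n 0 \<and> (\<forall>m<n. \<exists>y. ?eval m y \<and> y > 0)"
      unfolding recf_eval_mu_iff cons normal_form_eval[OF f] by (rule refl)
    also have "\<dots> \<longleftrightarrow> (\<exists>s. n < s \<and> ?P s v n)"
    proof
      assume L: "?eval n 0 \<and> (\<forall>m<n. \<exists>y. ?eval m y \<and> y > 0)"
      then obtain s where s: "F s (case_nat n v) = Suc 0" by blast
      from L obtain y t where yt: "y m > 0" "F (t m) (case_nat m v) = Suc (y m)" if "m < n" for m
        by metis
      let ?s = "Suc n + s + (\<Sum>m<n. t m)"
      have "Suc 0 < F ?s (case_nat m v)" if "m < n" for m
      proof -
        have "t m \<le> ?s" using member_le_sum[of m "{..<n}" t] that by simp
        from normal_form_mono[OF f, OF yt(2)[OF that] this] yt(1)[OF that] show ?thesis by simp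
      qed
      moreover have "F ?s (case_nat n v) = Suc 0"
        by (rule normal_form_mono[OF f, OF s]) simp
      ultimately show "\<exists>s. n < s \<and> ?P s v n" by (intro exI[of _ ?s]) auto
    next
      assume "\<exists>s. n < s \<and> ?P s v n"
      then obtain s where s: "?P s v n" by blast
      have "\<exists>y. ?eval m y \<and> y > 0" if "m < n" for m
        using s that by (intro exI[of _ "F s (case_nat m v) - 1"]) (auto intro!: exI[of _ s])
      with s show "?eval n 0 \<and> (\<forall>m<n. \<exists>y. ?eval m y \<and> y > 0)" by blast
    qed
    finally show ?thesis unfolding G .
  qed
  show ?thesis
    by (intro exI normal_formI) (rule comp, rule mono, assumption+, rule eval)
qed

text \<open>
  By induction on the term.  The arity \<open>k\<close> is arbitrary in the induction because the subterms
  of a recursion or a search take more arguments than the term itself.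
\<close>

lemma Kleene_normal_form: "\<exists>G. normal_form f k G"
proof (induction f arbitrary: k)
  case RZero
  show ?case
    by (rule normal_form_total[of "\<lambda>_. 0"]) (auto intro: computable_with_zero recf_eval.zero elim: recf_eval_elims)
next
  case RSucc
  show ?case
  proof (cases k)
    case 0
    then show ?thesis
      by (intro normal_form_diverges) (auto elim: recf_eval_elims)
  next
    case (Suc k')
    show ?thesis
      by (rule normal_form_total[of "\<lambda>v. Suc (v 0)"])
        (auto simp: Suc map_upt_Suc simp del: upt_Suc intro: computable_with_Suc computable_with_var recf_eval.succ elim: recf_eval_elims)
  qed
next
  case (RProj i)
  show ?case
  proof (cases "i < k")
    case False
    then show ?thesis
      by (intro normal_form_diverges) (auto elim: recf_eval_elims)
  next
    case True
    have "recf_eval no_oracle (RProj i) (map v [0..<k]) (v i)" for v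
      using recf_eval.proj[of i "map v [0..<k]"] True by simp
    then show ?thesis
      using True by (intro normal_form_total[of "\<lambda>v. v i"]) (auto intro: computable_with_var elim: recf_eval_elims)
  qed
next
  case ROracle
  show ?case
  proof (cases k)
    case 0
    then show ?thesis
      by (intro normal_form_diverges) (auto elim: recf_eval_elims)
  next
    case (Suc k')
    have "recf_eval no_oracle ROracle (x # xs) y \<longleftrightarrow> y = 0" for x xs y
      using recf_eval.query[of no_oracle x xs] by (auto elim: recf_eval_elims)
    then show ?thesis
      by (intro normal_form_total[of "\<lambda>_. 0"]) (auto simp: Suc map_upt_Suc simp del: upt_Suc intro: computable_with_zero)
  qed
next
  case (RComp f gs)
  obtain F where "normal_form f (length gs) F" using RComp by blast
  moreover obtain H where "i < length gs \<Longrightarrow> normal_form (gs ! i) k (H i)" for i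
  proof -
    have "\<forall>i. \<exists>G. i < length gs \<longrightarrow> normal_form (gs ! i) k G" using RComp.IH(2) nth_mem by blast
    from choice[OF this] show thesis using that by blast
  qed
  ultimately show ?case by (rule normal_form_comp)
next
  case (RPrim f g)
  show ?case
  proof (cases k)
    case 0
    then show ?thesis
      by (intro normal_form_diverges) (auto elim: recf_eval_elims)
  next
    case (Suc k')
    then show ?thesis using RPrim normal_form_prim by blast
  qed
next
  case (RMu f)
  then show ?case using normal_form_mu by blast
qed

section \<open>Cantor space and the coin-tossing measure\<close>

lemma cylinder_map_upt: "cylinder (map x [0..<n]) = {y. \<forall>i<n. y i = x i}"
  by (auto simp: cylinder_def)

lemma open_cylinder: "open (cylinder \<sigma>)"
proof -
  have "cylinder \<sigma> = (\<Inter>i<length \<sigma>. (\<lambda>x. x i) -` {\<sigma> ! i})"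
    by (auto simp: cylinder_def)
  moreover have "open ((\<lambda>x :: cantor. x i) -` {b})" for i b
    by (rule open_vimage[OF discrete_topology_class.open_discrete continuous_on_product_coordinates])
  ultimately show ?thesis by auto
qed

lemma open_contains_cylinder:
  assumes "open S" "x \<in> S"
  obtains n where "{y :: cantor. \<forall>i<n. y i = x i} \<subseteq> S"
proof -
  obtain X where X: "x \<in> Pi\<^sub>E UNIV X" "finite {i. X i \<noteq> UNIV}" "Pi\<^sub>E UNIV X \<subseteq> S"
    using product_topology_open_contains_basis[of "\<lambda>_. euclidean" UNIV S x] assms
    by (auto simp: open_fun_def)
  obtain n where n: "i < n" if "X i \<noteq> UNIV" for i
    using X(2) finite_nat_set_iff_bounded by auto
  have "{y. \<forall>i<n. y i = x i} \<subseteq> Pi\<^sub>E UNIV X"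
  proof
    fix y assume "y \<in> {y. \<forall>i<n. y i = x i}"
    then have "y i \<in> X i" for i
      using PiE_mem[OF X(1), of i] n[of i] by (cases "X i = UNIV") auto
    then show "y \<in> Pi\<^sub>E UNIV X" by (simp add: PiE_iff)
  qed
  then show thesis by (rule that[OF subset_trans[OF _ X(3)]])
qed

lemma in_closure_cantor_iff:
  "x \<in> closure S \<longleftrightarrow> (\<forall>n. \<exists>y\<in>S. \<forall>i<n. y i = (x :: cantor) i)"
proof
  assume x: "x \<in> closure S"
  show "\<forall>n. \<exists>y\<in>S. \<forall>i<n. y i = x i"
  proof
    fix n
    have "x \<in> cylinder (map x [0..<n])" by (simp add: cylinder_map_upt)
    then have "cylinder (map x [0..<n]) \<inter> S \<noteq> {}"
      using x open_cylinder by (metis IntI empty_iff open_Int_closure_eq_empty)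
    then show "\<exists>y\<in>S. \<forall>i<n. y i = x i" by (auto simp: cylinder_map_upt)
  qed
next
  assume R: "\<forall>n. \<exists>y\<in>S. \<forall>i<n. y i = x i"
  show "x \<in> closure S"
    unfolding closure_iff_nhds_not_empty
  proof (intro allI impI)
    fix A V :: "cantor set" assume "V \<subseteq> A" "open V" "x \<in> V"
    obtain n where "{y. \<forall>i<n. y i = x i} \<subseteq> V"
      by (rule open_contains_cylinder[OF \<open>open V\<close> \<open>x \<in> V\<close>])
    moreover from R obtain y where "y \<in> S" "\<forall>i<n. y i = x i" by blast
    ultimately have "y \<in> S \<inter> A" using \<open>V \<subseteq> A\<close> by auto
    then show "S \<inter> A \<noteq> {}" by blast
  qed
qed

text \<open>
  Every neighbourhood contains a cylinder, and it suffices to extend the string of that cylinder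
  to one whose cylinder misses the set.
\<close>

lemma nowhere_dense_cantorI:
  fixes S :: "cantor set"
  assumes "\<And>x n. \<exists>z m. (\<forall>i<n. z i = x i) \<and> (\<forall>y\<in>S. \<exists>i<m. y i \<noteq> z i)"
  shows "nowhere_dense S"
proof (rule ccontr)
  assume "\<not> nowhere_dense S"
  then obtain x where "x \<in> interior (closure S)" unfolding nowhere_dense_def by blast
  then obtain n where n: "{y. \<forall>i<n. y i = x i} \<subseteq> interior (closure S)"
    by (rule open_contains_cylinder[OF open_interior])
  from assms[of n x] obtain z m where z: "\<forall>i<n. z i = x i" "\<forall>y\<in>S. \<exists>i<m. y i \<noteq> z i"
    by (elim exE conjE)
  have "z \<in> interior (closure S)" by (rule subsetD[OF n]) (simp add: z(1))
  then have "z \<in> closure S" by (rule subsetD[OF interior_subset])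
  then obtain y where "y \<in> S" "\<forall>i<m. y i = z i" unfolding in_closure_cantor_iff by blast
  with z(2) show False by blast
qed

lemma prob_space_coin: "prob_space coin_measure"
  unfolding coin_measure_def by (intro prob_space_PiM) (rule measure_pmf.prob_space_axioms)

lemma cylinder_measure:
  "cylinder \<sigma> \<in> sets coin_measure \<and> measure coin_measure (cylinder \<sigma>) = (1/2) ^ length \<sigma>"
proof -
  let ?M = "\<lambda>_::nat. measure_pmf (bernoulli_pmf (1/2))"
  interpret product_prob_space ?M UNIV
    by unfold_locales
  have cyl: "cylinder \<sigma> = prod_emb UNIV ?M {..<length \<sigma>} (Pi\<^sub>E {..<length \<sigma>} (\<lambda>i. {\<sigma> ! i}))"
    by (simp add: set_eq_iff cylinder_def prod_emb_iff restrict_PiE_iff Pi_iff Ball_def)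
  have "cylinder \<sigma> \<in> sets coin_measure"
    unfolding cyl coin_measure_def by (rule sets_PiM_I) auto
  moreover have "measure coin_measure (cylinder \<sigma>) = (\<Prod>i<length \<sigma>. measure (?M i) {\<sigma> ! i})"
    unfolding cyl coin_measure_def by (rule measure_PiM_emb) auto
  moreover have "measure (?M i) {b} = 1/2" for i b
    by (cases b) (simp_all add: measure_pmf_single)
  ultimately show ?thesis by simp
qed

section \<open>Binary strings\<close>

text \<open>
  The binary digits of \<open>v\<close>, most significant first, of which the lowest \<open>k\<close> are kept.  Numbers
  \<open>v \<ge> 2 ^ k\<close> are thereby read modulo \<open>2 ^ k\<close>, as happens with \<open>binary_expansion\<close>, which ignores
  the integer part.
\<close>

primrec string_of :: "nat \<Rightarrow> nat \<Rightarrow> bool list" where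
  "string_of 0 v = []"
| "string_of (Suc k) v = odd (v div 2 ^ k) # string_of k v"

lemma length_string_of [simp]: "length (string_of k v) = k"
  by (induction k) auto

lemma nth_string_of: "i < k \<Longrightarrow> string_of k v ! i = odd (v div 2 ^ (k - Suc i))"
proof (induction k arbitrary: i)
  case (Suc k)
  then show ?case by (cases i) auto
qed simp

lemma str_code_Nil: "str_code [] = 0"
  by (simp add: str_code_def)

lemma str_code_Cons: "str_code (b # \<sigma>) = Suc (prod_encode (of_bool b, str_code \<sigma>))"
  by (simp add: str_code_def)

lemma inj_str_code: "inj str_code"
proof -
  have "inj (of_bool :: bool \<Rightarrow> nat)" by (auto simp: inj_def of_bool_eq_iff)
  then show ?thesis
    by (intro injI) (simp add: str_code_def list_encode_eq inj_map_eq_map)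
qed

lemma computable_with_str_code [computability]:
  assumes "computable_with p X" "computable_with p Y"
  shows "computable_with p (\<lambda>v. str_code (string_of (X v) (Y v)))"
proof (rule computable_with_subst2[OF _ assms])
  have "str_code (string_of k v) =
      rec_nat 0 (\<lambda>i c. Suc (prod_encode (of_bool (odd (v div 2 ^ i)), c))) k" for k v
    by (induction k) (auto simp: str_code_Nil str_code_Cons)
  then show "computable_with p (\<lambda>v. str_code (string_of (v 0) (v 1)))"
    by (simp only:) (intro computability)
qed

lemma string_of_add_power: "string_of k (2 ^ k + v) = string_of k v"
  for v :: nat
proof -
  have "odd ((2 ^ l * 2 ^ Suc m + v) div 2 ^ l) = odd (v div 2 ^ l)" for l m
    by (subst div_mult_self4) auto
  then have "string_of l (2 ^ (l + m) + v) = string_of l v" for l m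
  proof (induction l arbitrary: m)
    case (Suc l)
    from Suc.IH[OF Suc.prems, of "Suc m"] Suc.prems[of l m] show ?case
      by (simp add: power_add mult_ac)
  qed simp
  from this[of k 0] show ?thesis by simp
qed

lemma bij_betw_string_of: "bij_betw (string_of k) {..<2 ^ k} {\<sigma>. length \<sigma> = k}"
proof -
  have surj: "\<exists>v<2 ^ length \<sigma>. string_of (length \<sigma>) v = \<sigma>" for \<sigma>
  proof (induction \<sigma>)
    case (Cons b \<sigma>)
    then obtain v where v: "v < 2 ^ length \<sigma>" "string_of (length \<sigma>) v = \<sigma>" by blast
    then show ?case
      by (intro exI[of _ "of_bool b * 2 ^ length \<sigma> + v"]) (auto simp: string_of_add_power)
  qed simp
  have image: "string_of k ` {..<2 ^ k} = {\<sigma>. length \<sigma> = k}"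
    using surj by force
  moreover have "card {\<sigma> :: bool list. length \<sigma> = k} = 2 ^ k"
    using card_lists_length_eq[of "UNIV :: bool set" k] by simp
  ultimately have "inj_on (string_of k) {..<2 ^ k}"
    by (intro eq_card_imp_inj_on) auto
  with image show ?thesis by (simp add: bij_betw_def)
qed

text \<open>
  Digit \<open>i\<close> of the expansion is the parity of \<open>\<lfloor>2 ^ Suc i * x\<rfloor>\<close>, and this number arises from
  \<open>\<lfloor>2 ^ k * x\<rfloor>\<close> by deleting the lowest \<open>k - Suc i\<close> binary digits.
\<close>

lemma binary_expansion_in_cylinder:
  assumes "0 \<le> x"
  shows "binary_expansion x \<in> cylinder (string_of k (nat \<lfloor>2 ^ k * x\<rfloor>))"
proof -
  have "binary_expansion x i = odd (nat \<lfloor>2 ^ k * x\<rfloor> div 2 ^ (k - Suc i))" if "i < k" for i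
  proof -
    have "2 ^ k = (2 ^ Suc i * 2 ^ (k - Suc i) :: real)"
      using that by (subst power_add[symmetric]) simp
    then have "2 ^ Suc i * x = 2 ^ k * x / real_of_int (2 ^ (k - Suc i))" by simp
    then have "\<lfloor>2 ^ Suc i * x\<rfloor> = \<lfloor>2 ^ k * x\<rfloor> div 2 ^ (k - Suc i)"
      by (simp only:) (rule floor_divide_real_eq_div, simp)
    also have "\<dots> = int (nat \<lfloor>2 ^ k * x\<rfloor> div 2 ^ (k - Suc i))"
      using assms by (simp add: zdiv_int)
    finally show ?thesis unfolding binary_expansion_def by simp
  qed
  then show ?thesis by (simp add: cylinder_def nth_string_of)
qed

lemma exists_number_with_bits: "\<exists>a :: nat. \<forall>j<u. odd (a div 2 ^ j) \<longleftrightarrow> P j"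
proof (intro exI allI impI)
  let ?a = "horner_sum of_bool 2 (map P [0..<u]) :: nat"
  show "odd (?a div 2 ^ j) \<longleftrightarrow> P j" if "j < u" for j
    using that by (simp flip: bit_iff_odd add: bit_horner_sum_bit_iff)
qed

section \<open>Approximations of a left-c.e. real\<close>

text \<open>
  The approximations are dyadic with denominator \<open>2 ^ t\<close> at stage \<open>t\<close>, so that all computations
  with them are computations with the numerators \<open>N t\<close>.
\<close>

locale left_ce_real =
  fixes N :: "nat \<Rightarrow> nat" and \<alpha> :: real
  assumes N_computable: "\<And>p. computable_with p (\<lambda>v. N (v 0))"
    and incseq_approx: "incseq (\<lambda>t. N t / 2 ^ t)"
    and approx_tendsto: "(\<lambda>t. N t / 2 ^ t) \<longlonglongrightarrow> \<alpha>"
begin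

definition approx :: "nat \<Rightarrow> real" where
  "approx t = N t / 2 ^ t"

lemma approx_mono: "t \<le> u \<Longrightarrow> approx t \<le> approx u"
  using incseq_approx unfolding approx_def by (rule incseqD)

lemma approx_le: "approx t \<le> \<alpha>"
  using incseq_le[OF incseq_approx approx_tendsto] unfolding approx_def .

lemma alpha_nonneg: "0 \<le> \<alpha>"
  using approx_le[of 0] by (rule order_trans[rotated]) (simp add: approx_def)

lemma computable_with_N [computability]: "computable_with p X \<Longrightarrow> computable_with p (\<lambda>v. N (X v))"
  by (rule computable_with_subst1[OF N_computable])

text \<open>
  At stage \<open>u\<close> it is visible that the approximation at stage \<open>t\<close> still misses \<open>\<alpha>\<close> by more
  than \<open>2 ^ - k\<close>; the formula is this comparison of approximations with the denominators
  cleared.  That some \<open>u\<close> makes \<open>t\<close> early is a c.e. condition, and it only holds for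
  finitely many \<open>t\<close> for a given \<open>k\<close>.
\<close>

definition early :: "nat \<Rightarrow> nat \<Rightarrow> nat \<Rightarrow> bool" where
  "early k t u \<longleftrightarrow> N t * 2 ^ u * 2 ^ k + 2 ^ t * 2 ^ u < N u * 2 ^ t * 2 ^ k"

lemma early_iff: "early k t u \<longleftrightarrow> approx t + (1/2) ^ k < approx u"
proof -
  have "early k t u \<longleftrightarrow> real (N t * 2 ^ u * 2 ^ k + 2 ^ t * 2 ^ u) < real (N u * 2 ^ t * 2 ^ k)"
    unfolding early_def by (rule of_nat_less_iff[symmetric])
  also have "\<dots> \<longleftrightarrow> approx t + (1/2) ^ k < approx u"
    by (simp add: approx_def power_one_over field_simps)
  finally show ?thesis .
qed

lemma early_mono: "early k t u \<Longrightarrow> t' \<le> t \<Longrightarrow> u \<le> u' \<Longrightarrow> early k t' u'"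
  using approx_mono[of t' t] approx_mono[of u u'] unfolding early_iff by linarith

lemma not_early_bound: "\<forall>u. \<not> early k t u \<Longrightarrow> \<alpha> \<le> approx t + (1/2) ^ k"
  using approx_tendsto unfolding early_iff approx_def[symmetric]
  by (intro LIMSEQ_le_const2) (auto simp: not_less)

lemma exists_not_early: "\<exists>t. \<forall>u. \<not> early k t u"
proof -
  have "\<alpha> - (1/2) ^ k < \<alpha>" by simp
  then have "eventually (\<lambda>t. \<alpha> - (1/2) ^ k < approx t) sequentially"
    using approx_tendsto unfolding approx_def[symmetric] by (rule order_tendstoD(1)[rotated])
  then obtain t where t: "\<alpha> - (1/2) ^ k < approx t"
    by (auto simp: eventually_sequentially)
  have "\<not> early k t u" for u
    using t approx_le[of u] unfolding early_iff by linarith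
  then show ?thesis by blast
qed

section \<open>The nowhere dense sets\<close>

text \<open>
  Up to position \<open>u\<close>, the bits of \<open>a\<close> do not contain a long gap: after every \<open>k \<ge> i\<close> there is
  a one at \<open>k\<close> itself or at a place that stage \<open>u\<close> knows to be early for \<open>k\<close>.
\<close>

definition admissible :: "nat \<Rightarrow> nat \<Rightarrow> nat \<Rightarrow> bool" where
  "admissible i u a \<longleftrightarrow>
    (\<forall>k<u. i \<le> k \<longrightarrow> (\<exists>t<u. k \<le> t \<and> odd (a div 2 ^ t) \<and> (t = k \<or> early k t u)))"

text \<open>
  An admissible string continues with ones, which creates no gap.  All other pairs \<open>(u, a)\<close>, in
  particular all those with \<open>u = 0\<close>, give the sequences that vanish from \<open>i\<close> on, whose finitely many
  possible initial segments are coded by \<open>a\<close>.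
\<close>

definition point :: "nat \<Rightarrow> nat \<Rightarrow> nat \<Rightarrow> cantor" where
  "point i u a j \<longleftrightarrow>
    (if 0 < u \<and> admissible i u a then u \<le> j \<or> odd (a div 2 ^ j) else j < i \<and> odd (a div 2 ^ j))"

definition points :: "nat \<Rightarrow> nat \<Rightarrow> cantor" where
  "points i n = (case prod_decode n of (u, a) \<Rightarrow> point i u a)"

lemma range_points: "range (points i) = {point i u a |u a. True}"
proof -
  have "points i n = point i (fst (prod_decode n)) (snd (prod_decode n))" for n
    by (simp add: points_def split_beta)
  moreover have "point i u a = points i (prod_encode (u, a))" for u a
    by (simp add: points_def)
  ultimately show ?thesis by blast
qed

lemma decidable_with_point [computability]:
  assumes "computable_with p X" "computable_with p Y"  "computable_with p Z" "computable_with p T"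
  shows "decidable_with p (\<lambda>v. point (X v) (Y v) (Z v) (T v))"
proof -
  have "decidable_with p (\<lambda>v. early (v 0) (v 1) (v 2))"
    unfolding early_def by (intro computability)
  from computable_with_subst3[OF this] have early: "decidable_with p (\<lambda>v. early (X v) (Y v) (Z v))"
    if "computable_with p X" "computable_with p Y" "computable_with p Z" for X Y Z using that by blast
  have "decidable_with p (\<lambda>v. admissible (v 0) (v 1) (v 2))"
    unfolding admissible_def by (intro computability early)
  from computable_with_subst3[OF this] have adm: "decidable_with p (\<lambda>v. admissible (X v) (Y v) (Z v))"
    if "computable_with p X" "computable_with p Y" "computable_with p Z" for X Y Z using that by blast
  have "of_bool (point (X v) (Y v) (Z v) (T v)) =
     (if 0 < Y v \<and> admissible (X v) (Y v) (Z v) then of_bool (Y v \<le> T v \<or> odd (Z v div 2 ^ T v))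
      else of_bool (T v < X v \<and> odd (Z v div 2 ^ T v)) :: nat)" for v
    by (simp add: point_def)
  then show ?thesis
    by (simp only:) (intro computability adm assms)
qed

text \<open>
  The exceptional \<open>p\<close>: those that vanish from \<open>i\<close> on, and those that have, for every \<open>k \<ge> i\<close>,
  a one at \<open>k\<close> or at a later place that is early for \<open>k\<close>.
\<close>

definition meagre_part :: "nat \<Rightarrow> cantor set" where
  "meagre_part i = closure (range (points i))"

lemma computable_meagre_part: "computable_Aplus_seq meagre_part"
proof -
  let ?j = "\<lambda>x. snd (prod_decode (snd (prod_decode x)))"
  let ?n = "\<lambda>x. fst (prod_decode (snd (prod_decode x)))"
  let ?i = "\<lambda>x. fst (prod_decode x)"
  define r :: "nat \<Rightarrow> nat" where "r x = (if ?j x = 0 then 0 else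
      of_bool (point (?i x) (fst (prod_decode (?n x))) (snd (prod_decode (?n x))) (?j x - 1)))" for x
  have "computable r"
    unfolding r_def by (rule computableI) (intro computability)
  moreover have "is_Aplus_name (component r i) (meagre_part i)" for i
    unfolding is_Aplus_name_def
  proof (intro exI conjI allI)
    show "is_point_name (component (component r i) n) (Some (points i n))" for n
      by (simp add: component_def r_def points_def split: prod.split)
    \<comment> \<open>The point at infinity is isolated, so the closure within Cantor space is the usual one.\<close>
    have "x \<in> closure S \<longleftrightarrow> Some x \<in> cantor_infty_top closure_of (Some ` S)" for x S
    proof -
      have "topspace cantor_infty_top = UNIV"
        using openin_subset[of cantor_infty_top UNIV] by (auto simp: openin_cantor_infty_top)
      then have "Some x \<in> cantor_infty_top closure_of (Some ` S) \<longleftrightarrow>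
          (\<forall>T. Some x \<in> T \<and> open (Some -` T) \<longrightarrow> (\<exists>y\<in>S. Some y \<in> T))"
        by (auto simp: in_closure_of openin_cantor_infty_top)
      also have "\<dots> \<longleftrightarrow> (\<forall>V. x \<in> V \<and> open V \<longrightarrow> (\<exists>y\<in>S. y \<in> V))"
      proof safe
        fix V assume R: "\<forall>T. Some x \<in> T \<and> open (Some -` T) \<longrightarrow> (\<exists>y\<in>S. Some y \<in> T)" "x \<in> V" "open V"
        have "Some -` Some ` V = V" by auto
        then show "\<exists>y\<in>S. y \<in> V" using R(1)[rule_format, of "Some ` V"] R(2,3) by auto
      next
        fix T assume L: "\<forall>V. x \<in> V \<and> open V \<longrightarrow> (\<exists>y\<in>S. y \<in> V)" "Some x \<in> T" "open (Some -` T)"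
        then show "\<exists>y\<in>S. Some y \<in> T" using L(1)[rule_format, of "Some -` T"] by auto
      qed
      also have "\<dots> \<longleftrightarrow> x \<in> closure S"
        unfolding closure_iff_nhds_not_empty by blast
      finally show ?thesis by simp
    qed
    then show "Some -` (cantor_infty_top closure_of range (\<lambda>n. Some (points i n))) = meagre_part i"
      unfolding meagre_part_def by (auto simp flip: image_image)
  qed
  ultimately show ?thesis unfolding computable_Aplus_seq_def by blast
qed

lemma point_cases:
  assumes "0 < u \<and> admissible i u a \<Longrightarrow>
      (\<And>k. i \<le> k \<Longrightarrow> \<exists>t\<ge>k. point i u a t \<and> (t = k \<or> (\<exists>u. early k t u))) \<Longrightarrow> thesis"
    and "(\<And>j. i \<le> j \<Longrightarrow> \<not> point i u a j) \<Longrightarrow> thesis"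
  shows thesis
proof (cases "0 < u \<and> admissible i u a")
  case True
  show ?thesis
  proof (rule assms(1)[OF True])
    fix k assume "i \<le> k"
    show "\<exists>t\<ge>k. point i u a t \<and> (t = k \<or> (\<exists>u. early k t u))"
    proof (cases "k < u")
      case True
      with \<open>0 < u \<and> admissible i u a\<close> \<open>i \<le> k\<close> show ?thesis
        unfolding admissible_def point_def by fastforce
    next
      case False
      then have "point i u a k" using True by (simp add: point_def)
      then show ?thesis by blast
    qed
  qed
next
  case False
  show ?thesis
    by (rule assms(2)) (use False in \<open>auto simp: point_def\<close>)
qed

text \<open>
  Any string extends by zeros from \<open>k\<close> on up to a place that is not early for \<open>k\<close>, which excludes
  the points without long gaps, and then by a single one, which excludes those that vanish from
  \<open>i\<close> on.
\<close>

lemma nowhere_dense_meagre_part: "nowhere_dense (meagre_part i)"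
proof -
  have "nowhere_dense (range (points i))"
  proof (rule nowhere_dense_cantorI)
    fix x :: cantor and n
    define k where "k = max n i"
    obtain T where T: "\<not> early k T u" for u using exists_not_early by blast
    define M where "M = max T (Suc k)"
    define z where "z j \<longleftrightarrow> (j < n \<and> x j) \<or> j = M" for j
    have "n \<le> k" "i \<le> k" "k < M" "T \<le> M" by (auto simp: k_def M_def)
    have "\<exists>j<Suc M. y j \<noteq> z j" if "y \<in> range (points i)" for y
    proof (rule ccontr)
      assume "\<not> (\<exists>j<Suc M. y j \<noteq> z j)"
      then have y: "y j = z j" if "j \<le> M" for j using that by (simp add: less_Suc_eq_le)
      obtain u a where ua: "y = point i u a" using \<open>y \<in> range (points i)\<close> unfolding range_points by blast
      show False
      proof (rule point_cases[of u i a])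
        assume "\<And>k. i \<le> k \<Longrightarrow> \<exists>t\<ge>k. point i u a t \<and> (t = k \<or> (\<exists>u. early k t u))"
        then obtain t where t: "k \<le> t" "y t" "t = k \<or> (\<exists>u. early k t u)"
          using \<open>i \<le> k\<close> ua by blast
        have "M \<le> t"
        proof (rule ccontr)
          assume "\<not> M \<le> t"
          with y[of t] t(1,2) \<open>n \<le> k\<close> show False by (simp add: z_def)
        qed
        then obtain u where "early k t u" using t(3) \<open>k < M\<close> by auto
        then have "early k T u" using early_mono \<open>M \<le> t\<close> \<open>T \<le> M\<close> by (meson order_refl order_trans)
        with T show False by blast
      next
        assume "\<And>j. i \<le> j \<Longrightarrow> \<not> point i u a j"
        moreover have "point i u a M" using y[of M] ua by (simp add: z_def)
        ultimately show False using \<open>i \<le> k\<close> \<open>k < M\<close> by auto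
      qed
    qed
    then show "\<exists>z m. (\<forall>i<n. z i = x i) \<and> (\<forall>y\<in>range (points i). \<exists>i<m. y i \<noteq> z i)"
      using \<open>n \<le> k\<close> \<open>k < M\<close> by (intro exI[of _ z] exI[of _ "Suc M"]) (auto simp: z_def)
  qed
  then show ?thesis by (simp add: nowhere_dense_def meagre_part_def)
qed

lemma eventually_zero_in_meagre_part:
  assumes "\<And>j. i \<le> j \<Longrightarrow> \<not> p j"
  shows "p \<in> meagre_part i"
proof -
  obtain a :: nat where a: "odd (a div 2 ^ j) \<longleftrightarrow> p j" if "j < i" for j
    using exists_number_with_bits[of i p] by blast
  have "p = point i 0 a"
    using a assms by (auto simp: point_def fun_eq_iff not_le[symmetric])
  then have "p \<in> range (points i)" unfolding range_points by blast
  then show ?thesis unfolding meagre_part_def by (rule subsetD[OF closure_subset])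
qed

text \<open>
  To approximate \<open>p\<close> up to \<open>m\<close>, copy its first \<open>m\<close> bits and continue with ones.  For \<open>k < m\<close> the
  one that \<open>p\<close> has at an early place \<open>t\<close> may have been overwritten, but then \<open>m \<le> t\<close> is early
  for \<open>k\<close> as well and carries a one.  The stage \<open>u\<close> must be large enough to see
  that all these finitely many places are early.
\<close>

lemma always_early_in_meagre_part:
  assumes p: "\<And>k. i \<le> k \<Longrightarrow> \<exists>t\<ge>k. p t \<and> (t = k \<or> (\<exists>u. early k t u))"
  shows "p \<in> meagre_part i"
  unfolding meagre_part_def in_closure_cantor_iff
proof
  fix m
  have "\<forall>k. \<exists>t u. i \<le> k \<longrightarrow> k \<le> t \<and> p t \<and> (t = k \<or> early k t u)"
    using p by blast
  then obtain t w where tw: "k \<le> t k" "p (t k)" "t k = k \<or> early k (t k) (w k)" if "i \<le> k" for k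
    by metis
  define u where "u = Suc m + (\<Sum>k<m. w k)"
  have u: "w k \<le> u" if "k < m" for k
    using member_le_sum[of k "{..<m}" w] that by (simp add: u_def)
  obtain a :: nat where a: "odd (a div 2 ^ j) \<longleftrightarrow> (j < m \<longrightarrow> p j)" if "j < u" for j
    using exists_number_with_bits[of u "\<lambda>j. j < m \<longrightarrow> p j"] by blast
  have "\<exists>t<u. k \<le> t \<and> odd (a div 2 ^ t) \<and> (t = k \<or> early k t u)" if k: "i \<le> k" "k < u" for k
  proof (cases "k < m")
    case False
    then show ?thesis using k a by auto
  next
    case True
    have early: "early k s u" if "s \<le> t k" "t k \<noteq> k" for s
      using tw(3)[OF k(1)] that u[OF True] early_mono by blast
    show ?thesis
    proof (cases "t k < m")
      case True
      then show ?thesis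
        using tw(1,2)[OF k(1)] a[of "t k"] early[of "t k"] by (intro exI[of _ "t k"]) (auto simp: u_def)
    next
      case False
      then show ?thesis
        using True a[of m] early[of m] by (intro exI[of _ m]) (auto simp: u_def)
    qed
  qed
  then have "admissible i u a" unfolding admissible_def by blast
  moreover have "0 < u" "m < u" by (auto simp: u_def)
  ultimately have "\<forall>j<m. point i u a j = p j" using a by (simp add: point_def)
  then show "\<exists>y\<in>range (points i). \<forall>j<m. y j = p j" unfolding range_points by blast
qed

section \<open>A test from the gaps\<close>

lemma infinitely_many_late:
  assumes p: "p \<notin> (\<Union>i. meagre_part i)"
  shows "\<exists>k\<ge>i. (\<exists>t\<ge>k. p t) \<and> (\<forall>t\<ge>k. p t \<longrightarrow> (\<forall>u. \<not> early k t u))"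
proof -
  obtain k where k: "i \<le> k" "\<And>t. k \<le> t \<Longrightarrow> p t \<Longrightarrow> t \<noteq> k \<and> (\<forall>u. \<not> early k t u)"
    using always_early_in_meagre_part[of i p] p by blast
  moreover have "\<exists>t\<ge>k. p t"
    using eventually_zero_in_meagre_part[of k p] p by blast
  ultimately show ?thesis by blast
qed

definition next_one :: "cantor \<Rightarrow> nat \<Rightarrow> nat \<Rightarrow> bool" where
  "next_one p k t \<longleftrightarrow> k \<le> t \<and> p t \<and> (\<forall>j<t. k \<le> j \<longrightarrow> \<not> p j)"

text \<open>
  For \<open>b = 0\<close> and \<open>b = 1\<close>, the cylinders of these two strings cover the interval of length
  \<open>2 ^ - k\<close> to the right of the approximation at stage \<open>t\<close>.
\<close>

definition candidate :: "nat \<Rightarrow> nat \<Rightarrow> nat \<Rightarrow> bool list" where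
  "candidate k t b = string_of k (2 ^ k * N t div 2 ^ t + b)"

lemma next_one_unique: "next_one p k t \<Longrightarrow> next_one p k t' \<Longrightarrow> t = t'"
  unfolding next_one_def by (meson linorder_neqE_nat)

lemma next_one_exists: "\<exists>t\<ge>k. p t \<Longrightarrow> \<exists>t. next_one p k t"
  unfolding next_one_def by (rule exI[of _ "LEAST t. k \<le> t \<and> p t"])
    (metis (mono_tags, lifting) LeastI not_less_Least)

text \<open>
  The oracle \<open>p\<close> proposes, for each precision \<open>k\<close>, the position of its first one from \<open>k\<close> on as
  a stage at which the approximation should be good up to \<open>2 ^ - k\<close>.
\<close>

definition gap_test :: "cantor \<Rightarrow> nat \<Rightarrow> cantor set" where
  "gap_test p n = \<Union> {cylinder (candidate k t b) |k t b. Suc n < k \<and> next_one p k t \<and> b < 2}"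

lemma ce_open_gap_test: "ce_open_seq p (gap_test p)"
proof -
  define P where "P w x \<longleftrightarrow> (\<exists>k<w. \<exists>t<w. next_one p k t \<and>
      (\<exists>n<k. Suc n < k \<and> (\<exists>b<2. x = prod_encode (n, str_code (candidate k t b)))))" for w x
  have "decidable_with p (\<lambda>v. P (v 0) (v 1))"
    unfolding P_def next_one_def candidate_def by (intro computability)
  then have "ce_in p {x. \<exists>w. P w x}" by (rule ce_inI)
  moreover have "(\<exists>w. P w (prod_encode (n, str_code \<sigma>))) \<longleftrightarrow>
      (\<exists>k t b. \<sigma> = candidate k t b \<and> Suc n < k \<and> next_one p k t \<and> b < 2)" for n \<sigma>
  proof
    assume "\<exists>k t b. \<sigma> = candidate k t b \<and> Suc n < k \<and> next_one p k t \<and> b < 2"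
    then obtain k t b where ktb: "\<sigma> = candidate k t b" "Suc n < k" "next_one p k t" "b < 2" by blast
    have "P (Suc (max k t)) (prod_encode (n, str_code \<sigma>))"
      unfolding P_def using ktb
      by (intro exI[of _ k] exI[of _ t] exI[of _ n] exI[of _ b] conjI) auto
    then show "\<exists>w. P w (prod_encode (n, str_code \<sigma>))" ..
  qed (auto simp: P_def inj_eq[OF inj_str_code])
  then have "gap_test p n = \<Union> {cylinder \<sigma> |\<sigma>. prod_encode (n, str_code \<sigma>) \<in> {x. \<exists>w. P w x}}" for n
    unfolding gap_test_def by (intro arg_cong[where f = Union]) auto
  ultimately show ?thesis unfolding ce_open_seq_def by blast
qed

text \<open>
  Each \<open>k\<close> contributes at most two cylinders of measure \<open>2 ^ - k\<close>, and the sum of \<open>2 * 2 ^ - k\<close> over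
  \<open>k \<ge> n + 2\<close> is \<open>2 ^ - n\<close>.
\<close>

lemma measure_gap_test: "measure coin_measure (gap_test p n) \<le> (1/2) ^ n"
proof -
  interpret prob_space coin_measure by (rule prob_space_coin)
  \<comment> \<open>If \<open>p\<close> has no one from \<open>k\<close> on, the description denotes an arbitrary number; this only enlarges
    the cover.\<close>
  define C where "C k = cylinder (candidate k (THE t. next_one p k t) 0) \<union>
    cylinder (candidate k (THE t. next_one p k t) 1)" for k
  have C: "C k \<in> sets coin_measure" "prob (C k) \<le> 2 * (1/2) ^ k" for k
  proof -
    show "C k \<in> sets coin_measure" unfolding C_def using cylinder_measure by blast
    have "prob (C k) \<le> prob (cylinder (candidate k (THE t. next_one p k t) 0)) +
        prob (cylinder (candidate k (THE t. next_one p k t) 1))"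
      unfolding C_def using cylinder_measure by (intro measure_Un_le) auto
    also have "\<dots> = 2 * (1/2) ^ k" using cylinder_measure by (simp add: candidate_def)
    finally show "prob (C k) \<le> 2 * (1/2) ^ k" .
  qed
  have sums: "(\<lambda>k. 2 * (1/2) ^ (k + n + 2)) sums ((1/2) ^ n :: real)"
  proof -
    have "(\<lambda>k. 2 * (1/2) ^ (n + 2) * (1/2) ^ k) sums (2 * (1/2) ^ (n + 2) * (1 / (1 - 1/2)) :: real)"
      by (intro sums_mult geometric_sums) simp
    then show ?thesis by (simp add: power_add mult_ac)
  qed
  have summable: "summable (\<lambda>k. prob (C (k + n + 2)))"
    by (rule summable_comparison_test'[OF sums_summable[OF sums], of 0])
      (simp only: real_norm_def abs_of_nonneg[OF measure_nonneg] C(2))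
  have "gap_test p n \<subseteq> (\<Union>k. C (k + n + 2))"
  proof
    fix x assume "x \<in> gap_test p n"
    then obtain k t b where x: "x \<in> cylinder (candidate k t b)" "Suc n < k" "next_one p k t" "b < 2"
      unfolding gap_test_def by blast
    have "(THE t. next_one p k t) = t"
      using x(3) next_one_unique by blast
    with x have "x \<in> C k" by (auto simp: C_def less_2_cases_iff)
    moreover have "k = (k - n - 2) + n + 2" using x(2) by simp
    ultimately show "x \<in> (\<Union>k. C (k + n + 2))" by (metis UNIV_I UN_I)
  qed
  then have "prob (gap_test p n) \<le> prob (\<Union>k. C (k + n + 2))"
    using C(1) by (intro finite_measure_mono) auto
  also have "\<dots> \<le> (\<Sum>k. prob (C (k + n + 2)))"
    using C(1) by (intro finite_measure_subadditive_countably summable) auto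
  also have "\<dots> \<le> (\<Sum>k. 2 * (1/2) ^ (k + n + 2))"
    by (intro suminf_le C(2) summable sums_summable[OF sums])
  also have "\<dots> = (1/2) ^ n" using sums by (rule sums_unique[symmetric])
  finally show ?thesis .
qed

text \<open>
  Multiplied by \<open>2 ^ k\<close>, the approximation lies at most \<open>1\<close> below \<open>\<alpha>\<close>, so the integer parts differ
  by \<open>0\<close> or \<open>1\<close>.
\<close>

lemma late_candidate:
  assumes "\<forall>u. \<not> early k t u"
  shows "\<exists>b<2. binary_expansion \<alpha> \<in> cylinder (candidate k t b)"
proof -
  let ?v = "2 ^ k * N t div 2 ^ t"
  have v: "int ?v = \<lfloor>2 ^ k * approx t\<rfloor>"
    using floor_divide_of_nat_eq[of "2 ^ k * N t" "2 ^ t", where ?'a = real] by (simp add: approx_def)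
  have "2 ^ k * approx t \<le> 2 ^ k * \<alpha>" using approx_le by simp
  then have "\<lfloor>2 ^ k * approx t\<rfloor> \<le> \<lfloor>2 ^ k * \<alpha>\<rfloor>" by (rule floor_mono)
  moreover have "2 ^ k * \<alpha> \<le> 2 ^ k * approx t + 1"
  proof -
    have "2 ^ k * \<alpha> \<le> 2 ^ k * (approx t + (1/2) ^ k)"
      using not_early_bound[OF assms] by simp
    then show ?thesis by (simp add: distrib_left power_one_over)
  qed
  then have "\<lfloor>2 ^ k * \<alpha>\<rfloor> \<le> \<lfloor>2 ^ k * approx t + 1\<rfloor>" by (rule floor_mono)
  then have "\<lfloor>2 ^ k * \<alpha>\<rfloor> \<le> \<lfloor>2 ^ k * approx t\<rfloor> + 1" by simp
  ultimately have "nat \<lfloor>2 ^ k * \<alpha>\<rfloor> = ?v + nat (\<lfloor>2 ^ k * \<alpha>\<rfloor> - \<lfloor>2 ^ k * approx t\<rfloor>)"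
    "nat (\<lfloor>2 ^ k * \<alpha>\<rfloor> - \<lfloor>2 ^ k * approx t\<rfloor>) < 2"
    using v by linarith+
  then show ?thesis
    using binary_expansion_in_cylinder[OF alpha_nonneg, of k] unfolding candidate_def by metis
qed

lemma not_MLR:
  assumes "p \<notin> (\<Union>i. meagre_part i)"
  shows "binary_expansion \<alpha> \<notin> MLR p"
proof -
  have "binary_expansion \<alpha> \<in> gap_test p n" for n
  proof -
    obtain k where k: "Suc (Suc n) \<le> k" "\<exists>t\<ge>k. p t" "\<forall>t\<ge>k. p t \<longrightarrow> (\<forall>u. \<not> early k t u)"
      using infinitely_many_late[OF assms] by blast
    obtain t where t: "next_one p k t" using next_one_exists[OF k(2)] by blast
    then have "\<forall>u. \<not> early k t u" using k(3) by (simp add: next_one_def)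
    then obtain b where "b < 2" "binary_expansion \<alpha> \<in> cylinder (candidate k t b)"
      using late_candidate by blast
    then show ?thesis using t k(1) unfolding gap_test_def by (auto simp: Suc_le_eq)
  qed
  moreover have "martin_loef_test p (gap_test p)"
    unfolding martin_loef_test_def using ce_open_gap_test measure_gap_test by blast
  ultimately show ?thesis unfolding MLR_def by blast
qed

theorem comeager_not_MLR:
  "\<exists>A. co_ce_comeager A \<and> (\<forall>p\<in>A. binary_expansion \<alpha> \<notin> MLR p)"
proof (intro exI conjI ballI)
  show "co_ce_comeager (- (\<Union>i. meagre_part i))"
    unfolding co_ce_comeager_def using computable_meagre_part nowhere_dense_meagre_part
    by (intro exI[of _ meagre_part]) simp
qed (use not_MLR in blast)

end

section \<open>Halting probabilities\<close>

lemma prefix_if_cylinders_meet: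
  assumes "x \<in> cylinder \<sigma>" "x \<in> cylinder \<tau>" "length \<sigma> \<le> length \<tau>"
  shows "prefix \<sigma> \<tau>"
proof -
  have "\<sigma> = take (length \<sigma>) \<tau>"
    using assms by (intro nth_equalityI) (auto simp: cylinder_def)
  then show ?thesis by (metis take_is_prefix)
qed

text \<open>
  The cylinders of a prefix-free set of strings are disjoint, and their measures are the summands.
\<close>

lemma Kraft_inequality:
  fixes F :: "bool list set"
  assumes "finite F" "\<And>\<sigma> \<tau>. \<sigma> \<in> F \<Longrightarrow> \<tau> \<in> F \<Longrightarrow> prefix \<sigma> \<tau> \<Longrightarrow> \<sigma> = \<tau>"
  shows "(\<Sum>\<sigma>\<in>F. (1/2) ^ length \<sigma>) \<le> (1::real)"
proof -
  interpret prob_space coin_measure by (rule prob_space_coin)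
  have disjoint: "disjoint_family_on cylinder F"
    unfolding disjoint_family_on_def
  proof (intro ballI impI)
    fix \<sigma> \<tau> assume st: "\<sigma> \<in> F" "\<tau> \<in> F" "\<sigma> \<noteq> \<tau>"
    show "cylinder \<sigma> \<inter> cylinder \<tau> = {}"
    proof (rule ccontr)
      assume "cylinder \<sigma> \<inter> cylinder \<tau> \<noteq> {}"
      then obtain x where "x \<in> cylinder \<sigma>" "x \<in> cylinder \<tau>" by blast
      then have "prefix \<sigma> \<tau> \<or> prefix \<tau> \<sigma>"
        using prefix_if_cylinders_meet nat_le_linear by blast
      with st assms(2) show False by blast
    qed
  qed
  have "(\<Sum>\<sigma>\<in>F. (1/2) ^ length \<sigma>) = (\<Sum>\<sigma>\<in>F. prob (cylinder \<sigma>))"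
    using cylinder_measure by simp
  also have "\<dots> = prob (\<Union>\<sigma>\<in>F. cylinder \<sigma>)"
    using cylinder_measure assms(1) disjoint
    by (intro finite_measure_finite_Union[symmetric]) auto
  also have "\<dots> \<le> 1" by (rule prob_le_1)
  finally show ?thesis .
qed

lemma halting_probability_has_sum:
  assumes "prefix_free_machine M"
  shows "((\<lambda>\<sigma>. (1/2) ^ length \<sigma>) has_sum halting_probability M) (dom M)"
  unfolding halting_probability_def
proof (rule has_sum_infsum, rule nonneg_bdd_above_summable_on)
  have prefix_free: "\<forall>\<sigma>\<in>dom M. \<forall>\<tau>\<in>dom M. prefix \<sigma> \<tau> \<longrightarrow> \<sigma> = \<tau>"
    using assms unfolding prefix_free_machine_def by (rule conjunct2)
  show "bdd_above (sum (\<lambda>\<sigma>. (1/2) ^ length \<sigma> :: real) ` {F. F \<subseteq> dom M \<and> finite F})"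
  proof (rule bdd_aboveI2)
    fix F assume "F \<in> {F. F \<subseteq> dom M \<and> finite F}"
    then show "(\<Sum>\<sigma>\<in>F. (1/2) ^ length \<sigma>) \<le> (1::real)"
      by (intro Kraft_inequality) (use prefix_free in blast)+
  qed
qed simp

text \<open>
  The domain of a machine is an increasing union of uniformly decidable sets, namely of the programs
  whose computation is seen to halt by a given stage.
\<close>

lemma halting_in_stages:
  assumes "prefix_free_machine M"
  shows "\<exists>halts :: nat \<Rightarrow> nat \<Rightarrow> bool.
    (\<forall>p. decidable_with p (\<lambda>v. halts (v 0) (v 1))) \<and>
    (\<forall>s s' c. halts s c \<longrightarrow> s \<le> s' \<longrightarrow> halts s' c) \<and>
    (\<forall>\<sigma>. \<sigma> \<in> dom M \<longleftrightarrow> (\<exists>s. halts s (str_code \<sigma>)))"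
proof -
  obtain f where f: "recf_eval no_oracle f [str_code \<sigma>] y \<longleftrightarrow> y \<in> str_code ` set_option (M \<sigma>)" for \<sigma> y
    using assms unfolding prefix_free_machine_def by blast
  obtain G where G: "normal_form f 1 G" using Kleene_normal_form by blast
  show ?thesis
  proof (intro exI[of _ "\<lambda>s c. 0 < G s (\<lambda>_. c)"] conjI allI impI)
    show "decidable_with p (\<lambda>v. 0 < G (v 0) (\<lambda>_. v 1))" for p
      by (intro decidable_with_less computable_with_zero normal_form_computable[OF G] computable_with_var)
    show "0 < G s' (\<lambda>_. c)" if "0 < G s (\<lambda>_. c)" "s \<le> s'" for s s' c
    proof -
      have "G s (\<lambda>_. c) = Suc (G s (\<lambda>_. c) - 1)" using that by simp
      from normal_form_mono[OF G, OF this that(2)] show ?thesis by simp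
    qed
    show "\<sigma> \<in> dom M \<longleftrightarrow> (\<exists>s. 0 < G s (\<lambda>_. str_code \<sigma>))" for \<sigma>
    proof -
      have "\<sigma> \<in> dom M \<longleftrightarrow> (\<exists>y. recf_eval no_oracle f [str_code \<sigma>] y)"
        unfolding f by auto
      also have "\<dots> \<longleftrightarrow> (\<exists>y s. G s (\<lambda>_. str_code \<sigma>) = Suc y)"
        using normal_form_eval[OF G, of "\<lambda>_. str_code \<sigma>"] by simp
      also have "\<dots> \<longleftrightarrow> (\<exists>s. 0 < G s (\<lambda>_. str_code \<sigma>))"
        by (auto simp: gr0_conv_Suc)
      finally show ?thesis .
    qed
  qed
qed

lemma halting_probability_left_ce:
  assumes M: "prefix_free_machine M"
  shows "\<exists>N. left_ce_real N (halting_probability M)"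
proof -
  obtain halts :: "nat \<Rightarrow> nat \<Rightarrow> bool" where
    halts_decidable: "\<forall>p. decidable_with p (\<lambda>v. halts (v 0) (v 1))"
    and halts_mono: "\<forall>s s' c. halts s c \<longrightarrow> s \<le> s' \<longrightarrow> halts s' c"
    and halts_iff: "\<forall>\<sigma>. \<sigma> \<in> dom M \<longleftrightarrow> (\<exists>s. halts s (str_code \<sigma>))"
    using halting_in_stages[OF M] by (elim exE conjE)
  \<comment> \<open>At stage \<open>t\<close> the programs shorter than \<open>t\<close> are run up to stage \<open>t\<close>, so \<open>2 ^ t\<close> is a common
    denominator of their weights.\<close>
  define N where "N t = (\<Sum>l<t. \<Sum>a<2 ^ l. if halts t (str_code (string_of l a)) then 2 ^ (t - l) else 0 :: nat)" for t
  define F where "F t = {\<sigma>. length \<sigma> < t \<and> halts t (str_code \<sigma>)}" for t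
  have N: "N t / 2 ^ t = (\<Sum>\<sigma>\<in>F t. (1/2) ^ length \<sigma>)" for t
  proof -
    let ?w = "\<lambda>\<sigma>. if halts t (str_code \<sigma>) then (1/2) ^ length \<sigma> else 0 :: real"
    have fin: "finite {\<sigma> :: bool list. length \<sigma> = l}" for l
      using finite_lists_length_eq[of "UNIV :: bool set" l] by simp
    have len: "length (string_of l a) = l" for l a
      by (induction l) auto
    have scale: "(2::real) ^ (t - l) / 2 ^ t = (1/2) ^ l" if "l < t" for l
      using that by (simp add: power_diff power_one_over)
    have "N t / 2 ^ t = (\<Sum>l<t. \<Sum>a<2 ^ l. ?w (string_of l a))"
      unfolding N_def of_nat_sum sum_divide_distrib
      by (intro sum.cong) (auto simp: len scale)
    also have "\<dots> = (\<Sum>l<t. \<Sum>\<sigma> | length \<sigma> = l. ?w \<sigma>)"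
      by (intro sum.cong refl sum.reindex_bij_betw bij_betw_string_of)
    also have "\<dots> = (\<Sum>\<sigma>\<in>(\<Union>l<t. {\<sigma>. length \<sigma> = l}). ?w \<sigma>)"
      using fin by (intro sum.UNION_disjoint[symmetric]) auto
    also have "\<dots> = (\<Sum>\<sigma>\<in>F t. (1/2) ^ length \<sigma>)"
      using fin by (intro sum.mono_neutral_cong_right) (auto simp: F_def)
    finally show ?thesis .
  qed
  have F: "finite (F t)" "F t \<subseteq> dom M" for t
  proof -
    show "F t \<subseteq> dom M" using halts_iff unfolding F_def by blast
    have "finite {\<sigma> :: bool list. length \<sigma> \<le> t}"
      using finite_lists_length_le[of "UNIV :: bool set" t] by simp
    then show "finite (F t)" by (rule rev_finite_subset) (auto simp: F_def)
  qed
  have F_mono: "F t \<subseteq> F u" if "t \<le> u" for t u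
    using that halts_mono unfolding F_def by fastforce
  have limit: "filterlim F (finite_subsets_at_top (dom M)) sequentially"
    unfolding filterlim_finite_subsets_at_top
  proof (intro allI impI)
    fix X assume X: "finite X \<and> X \<subseteq> dom M"
    then have "\<forall>\<sigma>. \<exists>s. \<sigma> \<in> X \<longrightarrow> halts s (str_code \<sigma>)" using halts_iff by blast
    then obtain s where s: "\<sigma> \<in> X \<Longrightarrow> halts (s \<sigma>) (str_code \<sigma>)" for \<sigma> by metis
    define u where "u = (\<Sum>\<sigma>\<in>X. s \<sigma> + Suc (length \<sigma>))"
    have "X \<subseteq> F u"
    proof
      fix \<sigma> assume \<sigma>: "\<sigma> \<in> X"
      then have "s \<sigma> + Suc (length \<sigma>) \<le> u"
        unfolding u_def using X by (intro member_le_sum) auto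
      then show "\<sigma> \<in> F u" using halts_mono[rule_format, OF s[OF \<sigma>]] by (simp add: F_def)
    qed
    then show "eventually (\<lambda>t. finite (F t) \<and> X \<subseteq> F t \<and> F t \<subseteq> dom M) sequentially"
      unfolding eventually_sequentially using F F_mono by blast
  qed
  have "left_ce_real N (halting_probability M)"
  proof
    show "computable_with p (\<lambda>v. N (v 0))" for p
      unfolding N_def by (intro computability computable_with_subst2[OF halts_decidable[rule_format]])
    show "incseq (\<lambda>t. N t / 2 ^ t)"
      unfolding N using F_mono F(1) by (intro monoI sum_mono2) auto
    show "(\<lambda>t. N t / 2 ^ t) \<longlonglongrightarrow> halting_probability M"
      unfolding N using halting_probability_has_sum[OF M] limit
      unfolding has_sum_def by (rule filterlim_compose)
  qed
  then show ?thesis by (rule exI[of _ N])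
qed

theorem proposition10p1:
  fixes U :: "bool list \<rightharpoonup> bool list"
  assumes "universal_prefix_free_machine U"
  shows "\<exists>A. co_ce_comeager A \<and> (\<forall>p\<in>A. \<not> low_for_Omega U p)"
proof -
  have "prefix_free_machine U"
    using assms unfolding universal_prefix_free_machine_def by blast
  then obtain N where "left_ce_real N (halting_probability U)"
    using halting_probability_left_ce by blast
  from left_ce_real.comeager_not_MLR[OF this] show ?thesis
    unfolding low_for_Omega_def Chaitin_Omega_def .
qed

end
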